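(* Let $a,b,q$ be real constants, let $f=f(x^3,x^4)$ be a nowhere vanishing smooth function, and let $M$ be a connected region of coordinates $(t,r,x^3,x^4)$ with $r\neq 0$, equipped with the Robinson-Trautman metric of Petrov type II $$ds^2=-2(a-2br-qr^{-1})\,dt^2+2\,dt\,dr-\frac{r^2}{f^2}\left[(dx^3)^2+(dx^4)^2\right].$$ Put $F=f_3^2+f_4^2-f(f_{33}+f_{44})$, where subscripts $3,4$ on functions denote partial derivatives in $x^3,x^4$. With the definitions of the context ($R,S,\kappa,C,P,W,K$ the Riemann, Ricci, scalar, conformal, projective, concircular and conharmonic curvatures), this metric possesses the following curvature properties. (i) It is Deszcz pseudosymmetric with $R\cdot R=\frac{q-2br^2}{r^3}Q(g,R)$. Hence it is Ricci pseudosymmetric, conformally pseudosymmetric, projectively pseudosymmetric, concircularly pseudosymmetric and conharmonically pseudosymmetric (that is, $R\cdot H=\frac{q-2br^2}{r^3}Q(g,H)$ for $H=S,C,P,W,K$ respectively), of non-constant type, with the same associated scalar. (ii) It satisfies $r^3(2ar-6q-Fr)\left[R\cdot R-Q(S,R)\right]=2\left(4aqr+4b^2r^4-12bqr^2-3q^2-2qFr\right)Q(g,C)$. (iii) It satisfies $C\cdot R=L\,Q(g,R)$ with $L=-\frac{2ar-6q-Fr}{6r^3}$. Hence $C\cdot S=L\,Q(g,S)$, $C\cdot C=L\,Q(g,C)$ (i.e., pseudosymmetric Weyl conformal curvature tensor), $C\cdot W=L\,Q(g,W)$, $C\cdot P=L\,Q(g,P)$ and $C\cdot K=L\,Q(g,K)$.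 (iv) If $4qr(a-3br)+4b^2r^4-3q^2-2qFr$ is nowhere zero, then it satisfies $C\cdot R-R\cdot C=L_1Q(g,R)+L_2Q(S,R)$ for $$L_1=-\frac{(2ar-6q-Fr)\left(2(aq+4b^2r^3-6bqr)-qF\right)}{3r^2\left(4qr(a-3br)+4b^2r^4-3q^2-2qFr\right)},\qquad L_2=\frac{(q-2br^2)(-2ar+6q+Fr)}{8qr(3br-a)-8b^2r^4+6q^2+4qFr}.$$ (v) It satisfies $C\cdot R-R\cdot C=L_1Q(g,C)+L_2Q(S,C)$ for $L_1=\frac{2(-2a+12br+F)}{3r^2}$ and $L_2=1$. (vi) If $-2ar+6q+Fr$ is everywhere nonzero, then its conformal curvature 2-forms are recurrent for the 1-form $$\Pi=\left\{0,\ \frac{F-2a}{-2ar+6q+Fr},\ \frac{F_3r}{-2ar+6q+Fr},\ \frac{F_4r}{-2ar+6q+Fr}\right\}.$$ (vii) If $-2a+4br+F$ is everywhere nonzero, then the metric is of Roter type with $R=N_1(S\wedge S)+N_2(g\wedge S)+N_3(g\wedge g)$, where $$N_1=\frac{r(2ar-6q-Fr)}{2(-2a+4br+F)^2},\qquad N_2=\frac{4abr^2+6aq+8b^2r^3-F(2br^2+3q)-36bqr}{r(-2a+4br+F)^2},$$ $$N_3=-\frac{1}{r^3}\left[-\frac{4br\left(6aq+8b^2r^3-24bqr-3qF\right)}{(-2a+4br+F)^2}+q\right].$$ (viii) It is 2-quasi-Einstein, as $S-\alpha g$ is of rank $2$ for $\alpha=\frac{2a-8br-F}{r^2}$ or $\alpha=-\frac{4b}{r}$.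 (ix) It is generalized quasi-Einstein in the sense of Chaki for $$\alpha=-\frac{-2a+8br+F}{r^2},\quad \beta=\frac{4b(-2a+4br+F)}{\Phi_1^2r},\quad \gamma=-2a+4br+F,$$ $$\Pi=\left\{\frac{q-ar}{\Phi_1r^3},\frac{1}{\Phi_1r^2},0,0\right\},\quad \Phi=\{\Phi_1,0,0,0\},$$ where $\Phi_1$ is an arbitrary scalar, $\|\Pi\|=-\frac{4b}{\Phi_1^2r^3}$ and $\|\Phi\|=0$. (x) It is generalized quasi-Einstein in the sense of De and Ghosh for $$\alpha=-\frac{4b}{r},\quad \beta=\gamma=\frac{-2a+4br+F}{r^2},\quad \Pi=\left\{0,0,\frac rf,0\right\},\quad \Phi=\left\{0,0,0,\frac rf\right\},$$ where $\|\Pi\|=\|\Phi\|=-1$ and $\Pi$ is orthogonal to $\Phi$. (xi) It is pseudo quasi-Einstein for $$\alpha=-\frac{F}{2r^2},\quad \beta=-\frac{4(a-6br)}{r^2},\quad \gamma=1,\quad \Pi=\left\{0,0,0,\frac rf\right\}.$$ (xii) A $(0,2)$-tensor of the form $$\begin{pmatrix} t_{11}&t_{12}&0&0\\ t_{12}&t_{22}&0&0\\ 0&0&t_{33}&t_{34}\\ 0&0&t_{34}&t_{44}\end{pmatrix},$$ with $t_{ij}$ arbitrary scalars, is $R$-compatible as well as $C$-compatible, $W$-compatible and $K$-compatible. So the Ricci tensor is $R$-compatible as well as $C$-compatible. Again, the vector (1-form) of the form $\{t_1,0,0,0\}$ or $\{0,t_2,0,0\}$ or $\{0,0,t_3,0\}$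 or $\{0,0,0,t_4\}$, with $t_i$ arbitrary scalars, is $R$-compatible as well as $C$-compatible.
   Context: Coordinates are numbered $(x^1,x^2,x^3,x^4)=(t,r,x^3,x^4)$, the dimension is $n=4$, and $\nabla$ is the Levi-Civita connection of $g$. 1-forms are given by their components in $dt,dr,dx^3,dx^4$; for a 1-form $\Pi$, $\|\Pi\|=g^{ij}\Pi_i\Pi_j$, and orthogonality is with respect to $g^{ij}$. "Scalar" means scalar function. Sign convention: $\mathcal R(X,Y)Z=\nabla_Y\nabla_XZ-\nabla_X\nabla_YZ+\nabla_{[X,Y]}Z$, $R(X_1,X_2,X_3,X_4)=g(\mathcal R(X_1,X_2)X_3,X_4)$, $S_{jk}=g^{il}R_{ijkl}$, $\kappa=g^{jk}S_{jk}$. With it, for this metric, $R_{1212}=-\frac{2q}{r^3}$, $S_{12}=-\frac{4b}{r}$, $S_{33}=S_{44}=-\frac{2a-8br-F}{f^2}$, $\kappa=-\frac{2(-2a+12br+F)}{r^2}$. Kulkarni-Nomizu product of symmetric $(0,2)$-tensors $A,E$: $(A\wedge E)(X_1,X_2,X_3,X_4)=A(X_1,X_4)E(X_2,X_3)+A(X_2,X_3)E(X_1,X_4)-A(X_1,X_3)E(X_2,X_4)-A(X_2,X_4)E(X_1,X_3)$. Curvature tensors ($n=4$): $C=R-\frac12(g\wedge S)+\frac{\kappa}{12}(g\wedge g)$, $W=R-\frac{\kappa}{24}(g\wedge g)$, $K=R-\frac12(g\wedge S)$, $P(X_1,X_2,X_3,X_4)=R(X_1,X_2,X_3,X_4)-\frac13[g(X_1,X_4)S(X_2,X_3)-g(X_2,X_4)S(X_1,X_3)]$.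 For a $(0,4)$-tensor $D$, let $\mathcal D$ be the $(1,3)$-tensor with $D(X_1,X_2,X_3,X_4)=g(\mathcal D(X_1,X_2)X_3,X_4)$. For a $(0,k)$-tensor $H$ and a symmetric $(0,2)$-tensor $A$: $(D\cdot H)(X_1,\dots,X_k,X,Y)=-\sum_{i=1}^kH(X_1,\dots,\mathcal D(X,Y)X_i,\dots,X_k)$, and $Q(A,H)(X_1,\dots,X_k,X,Y)=\sum_{i=1}^k\left[A(X,X_i)H(X_1,\dots,Y,\dots,X_k)-A(Y,X_i)H(X_1,\dots,X,\dots,X_k)\right]$, where $Y$ (resp. $X$) stands in the $i$-th place. A pseudosymmetry condition $R\cdot H=L\,Q(g,H)$ is of constant type if its associated scalar $L$ is constant, and of non-constant type otherwise. A metric is 2-quasi-Einstein if at each point $\operatorname{rank}(S-\alpha g)\le2$ for a scalar $\alpha$. A metric is pseudo quasi-Einstein if $S=\alpha g+\beta\,\Pi\otimes\Pi+\gamma E$ for some scalars $\alpha,\beta,\gamma$, a 1-form $\Pi$ and a trace-free $(0,2)$-tensor $E$ such that the vector field $V$ associated with $\Pi$ satisfies $E(X,V)=0$ for all $X$. In particular, it is called generalized quasi-Einstein in the sense of De and Ghosh if $E=\Phi\otimes\Phi$, and in the sense of Chaki if $E=\Pi\otimes\Phi+\Phi\otimes\Pi$, for a 1-form $\Phi$. The conformal curvature 2-forms are recurrent for a 1-form $\Pi$ if, for all vector fields, $(\nabla_{X_1}C)(X_2,X_3,X,Y)+(\nabla_{X_2}C)(X_3,X_1,X,Y)+(\nabla_{X_3}C)(X_1,X_2,X,Y)=\Pi(X_1)C(X_2,X_3,X,Y)+\Pi(X_2)C(X_3,X_1,X,Y)+\Pi(X_3)C(X_1,X_2,X,Y)$.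 A symmetric $(0,2)$-tensor $E$, with $\mathcal E$ defined by $E(X,Y)=g(\mathcal EX,Y)$, is $D$-compatible (for a $(0,4)$-tensor $D$) if $D(\mathcal EX_1,X,X_2,X_3)+D(\mathcal EX_2,X,X_3,X_1)+D(\mathcal EX_3,X,X_1,X_2)=0$ for all vector fields; a 1-form $\Pi$ is $D$-compatible if $\Pi\otimes\Pi$ is.
   Formalization: Non-constant type in (i) iff b or q is nonzero; rank 2 in (viii) iff -2a+4br+F≠0; (ix) holds with Π, Φ exchanged and Φ_1 nowhere zero; E in (ix), (x) need not be trace-free, nor E(X,V)=0 in (ix); (xi) uses corrected α, β (printed ones iff 4a-32br+F=0). *)

theory Defs
  imports "HOL-Analysis.Analysis"
begin

text \<open>
  Everything lives in a coordinate domain of \<^typ>\<open>real^4\<close> with coordinates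
  \<open>x$1 = t\<close>, \<open>x$2 = r\<close>, \<open>x$3\<close>, \<open>x$4\<close> (in the index type \<^typ>\<open>4\<close>, the numeral 4 is 0).
  A tensor at a point is the array of its components in the coordinate frame, so identities
  quantified over all vector fields become equalities of arrays. The first index is the
  outermost one: the component \<open>T(\<partial>\<^sub>i, \<partial>\<^sub>j, \<partial>\<^sub>k, \<partial>\<^sub>l)\<close> is \<open>T $ i $ j $ k $ l\<close>.
\<close>

type_synonym point = "real^4"
type_synonym tensor1 = "real^4"
type_synonym tensor2 = "real^4^4"
type_synonym tensor4 = "real^4^4^4^4"
type_synonym tensor5 = "real^4^4^4^4^4"
type_synonym tensor6 = "real^4^4^4^4^4^4"

type_synonym scalar_field = "point \<Rightarrow> real"
type_synonym vector_field = "point \<Rightarrow> real^4"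
type_synonym metric = "point \<Rightarrow> tensor2"


section \<open>Smooth functions and partial derivatives\<close>

fun times_differentiable_on ::
  "nat \<Rightarrow> 'a::real_normed_vector set \<Rightarrow> ('a \<Rightarrow> 'b::real_normed_vector) \<Rightarrow> bool"
where
  "times_differentiable_on 0 U h = continuous_on U h"
| "times_differentiable_on (Suc n) U h =
     ((\<forall>x\<in>U. h differentiable (at x)) \<and>
      (\<forall>v. times_differentiable_on n U (\<lambda>x. frechet_derivative h (at x) v)))"

definition smooth_on ::
  "'a::real_normed_vector set \<Rightarrow> ('a \<Rightarrow> 'b::real_normed_vector) \<Rightarrow> bool" where
  "smooth_on U h \<longleftrightarrow> (\<forall>n. times_differentiable_on n U h)"

definition pdiff :: "4 \<Rightarrow> scalar_field \<Rightarrow> scalar_field" where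
  "pdiff i h x = deriv (\<lambda>s. h (x + s *\<^sub>R axis i 1)) 0"


section \<open>Levi-Civita connection and curvature\<close>

definition christoffel :: "metric \<Rightarrow> point \<Rightarrow> 4 \<Rightarrow> 4 \<Rightarrow> 4 \<Rightarrow> real" where
  \<comment> \<open>\<open>christoffel g x k i j\<close> is \<open>\<Gamma>\<^sup>k\<^sub>i\<^sub>j\<close>\<close>
  "christoffel g x k i j =
     (1/2) * (\<Sum>l\<in>UNIV. matrix_inv (g x) $ k $ l *
       (pdiff i (\<lambda>y. g y $ j $ l) x + pdiff j (\<lambda>y. g y $ i $ l) x - pdiff l (\<lambda>y. g y $ i $ j) x))"

definition nabla :: "metric \<Rightarrow> vector_field \<Rightarrow> vector_field \<Rightarrow> vector_field" where
  "nabla g X Z x =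
     (\<chi> k. \<Sum>i\<in>UNIV. X x $ i *
        (pdiff i (\<lambda>y. Z y $ k) x + (\<Sum>j\<in>UNIV. christoffel g x k i j * Z x $ j)))"

definition lie_bracket :: "vector_field \<Rightarrow> vector_field \<Rightarrow> vector_field" where
  "lie_bracket X Y x =
     (\<chi> k. \<Sum>i\<in>UNIV. X x $ i * pdiff i (\<lambda>y. Y y $ k) x - Y x $ i * pdiff i (\<lambda>y. X y $ k) x)"

definition curvature_op ::
  "metric \<Rightarrow> vector_field \<Rightarrow> vector_field \<Rightarrow> vector_field \<Rightarrow> vector_field" where
  \<comment> \<open>the opposite of the more common sign convention\<close>
  "curvature_op g X Y Z x =
     nabla g Y (nabla g X Z) x - nabla g X (nabla g Y Z) x + nabla g (lie_bracket X Y) Z x"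

definition coord_field :: "4 \<Rightarrow> vector_field" where
  "coord_field i x = axis i 1"

definition riemann :: "metric \<Rightarrow> point \<Rightarrow> tensor4" where
  "riemann g x =
     (\<chi> i j k l. curvature_op g (coord_field i) (coord_field j) (coord_field k) x
                   \<bullet> (g x *v coord_field l x))"

definition ricci :: "metric \<Rightarrow> point \<Rightarrow> tensor2" where
  "ricci g x = (\<chi> j k. \<Sum>i\<in>UNIV. \<Sum>l\<in>UNIV. matrix_inv (g x) $ i $ l * riemann g x $ i $ j $ k $ l)"

definition metric_trace :: "tensor2 \<Rightarrow> tensor2 \<Rightarrow> real" where
  "metric_trace G E = (\<Sum>j\<in>UNIV. \<Sum>k\<in>UNIV. matrix_inv G $ j $ k * E $ j $ k)"

definition scalar_curvature :: "metric \<Rightarrow> scalar_field" where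
  "scalar_curvature g x = metric_trace (g x) (ricci g x)"

definition kulkarni_nomizu :: "tensor2 \<Rightarrow> tensor2 \<Rightarrow> tensor4" (infixl "\<owedge>" 70) where
  "A \<owedge> E = (\<chi> i j k l. A $ i $ l * E $ j $ k + A $ j $ k * E $ i $ l
                     - A $ i $ k * E $ j $ l - A $ j $ l * E $ i $ k)"

definition conformal :: "metric \<Rightarrow> point \<Rightarrow> tensor4" where
  "conformal g x = riemann g x - (1/2) *\<^sub>R (g x \<owedge> ricci g x)
                     + (scalar_curvature g x / 12) *\<^sub>R (g x \<owedge> g x)"

definition concircular :: "metric \<Rightarrow> point \<Rightarrow> tensor4" where
  "concircular g x = riemann g x - (scalar_curvature g x / 24) *\<^sub>R (g x \<owedge> g x)"

definition conharmonic :: "metric \<Rightarrow> point \<Rightarrow> tensor4" where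
  "conharmonic g x = riemann g x - (1/2) *\<^sub>R (g x \<owedge> ricci g x)"

definition projective :: "metric \<Rightarrow> point \<Rightarrow> tensor4" where
  "projective g x =
     (\<chi> i j k l. riemann g x $ i $ j $ k $ l
        - (1/3) * (g x $ i $ l * ricci g x $ j $ k - g x $ j $ l * ricci g x $ i $ k))"

definition nabla4 :: "metric \<Rightarrow> (point \<Rightarrow> tensor4) \<Rightarrow> point \<Rightarrow> tensor5" where
  \<comment> \<open>the first index is the direction of differentiation\<close>
  "nabla4 g T x =
     (\<chi> e i j k l. pdiff e (\<lambda>y. T y $ i $ j $ k $ l) x
        - (\<Sum>m\<in>UNIV. christoffel g x m e i * T x $ m $ j $ k $ l
                  + christoffel g x m e j * T x $ i $ m $ k $ l
                  + christoffel g x m e k * T x $ i $ j $ m $ l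
                  + christoffel g x m e l * T x $ i $ j $ k $ m))"


section \<open>The tensors \<open>D \<cdot> H\<close> and \<open>Q(A, H)\<close>\<close>

definition raise4 :: "tensor2 \<Rightarrow> tensor4 \<Rightarrow> 4 \<Rightarrow> 4 \<Rightarrow> 4 \<Rightarrow> real^4" where
  \<comment> \<open>the vector \<open>\<D>(\<partial>\<^sub>i, \<partial>\<^sub>j)\<partial>\<^sub>k\<close> with \<open>D(\<partial>\<^sub>i, \<partial>\<^sub>j, \<partial>\<^sub>k, \<partial>\<^sub>l) = G(\<D>(\<partial>\<^sub>i, \<partial>\<^sub>j)\<partial>\<^sub>k, \<partial>\<^sub>l)\<close>\<close>
  "raise4 G D i j k = (\<chi> m. \<Sum>l\<in>UNIV. matrix_inv G $ m $ l * D $ i $ j $ k $ l)"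

definition dot2 :: "tensor2 \<Rightarrow> tensor4 \<Rightarrow> tensor2 \<Rightarrow> tensor4" where
  "dot2 G D H =
     (\<chi> i j x y. - (\<Sum>m\<in>UNIV. raise4 G D x y i $ m * H $ m $ j
                          + raise4 G D x y j $ m * H $ i $ m))"

definition dot4 :: "tensor2 \<Rightarrow> tensor4 \<Rightarrow> tensor4 \<Rightarrow> tensor6" where
  "dot4 G D H =
     (\<chi> i j k l x y. - (\<Sum>m\<in>UNIV. raise4 G D x y i $ m * H $ m $ j $ k $ l
                              + raise4 G D x y j $ m * H $ i $ m $ k $ l
                              + raise4 G D x y k $ m * H $ i $ j $ m $ l
                              + raise4 G D x y l $ m * H $ i $ j $ k $ m))"

definition tachibana2 :: "tensor2 \<Rightarrow> tensor2 \<Rightarrow> tensor4" where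
  "tachibana2 A H =
     (\<chi> i j x y. A $ x $ i * H $ y $ j - A $ y $ i * H $ x $ j
               + A $ x $ j * H $ i $ y - A $ y $ j * H $ i $ x)"

definition tachibana4 :: "tensor2 \<Rightarrow> tensor4 \<Rightarrow> tensor6" where
  "tachibana4 A H =
     (\<chi> i j k l x y. A $ x $ i * H $ y $ j $ k $ l - A $ y $ i * H $ x $ j $ k $ l
                   + A $ x $ j * H $ i $ y $ k $ l - A $ y $ j * H $ i $ x $ k $ l
                   + A $ x $ k * H $ i $ j $ y $ l - A $ y $ k * H $ i $ j $ x $ l
                   + A $ x $ l * H $ i $ j $ k $ y - A $ y $ l * H $ i $ j $ k $ x)"


section \<open>Geometric structures on a coordinate domain\<close>

definition form_inner :: "tensor2 \<Rightarrow> tensor1 \<Rightarrow> tensor1 \<Rightarrow> real" where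
  "form_inner G \<eta> \<Phi> = (\<Sum>i\<in>UNIV. \<Sum>j\<in>UNIV. matrix_inv G $ i $ j * \<eta> $ i * \<Phi> $ j)"

definition form_prod :: "tensor1 \<Rightarrow> tensor1 \<Rightarrow> tensor2" where
  "form_prod \<eta> \<Phi> = (\<chi> i j. \<eta> $ i * \<Phi> $ j)"

definition two_quasi_einstein :: "point set \<Rightarrow> metric \<Rightarrow> bool" where
  "two_quasi_einstein M g \<longleftrightarrow>
     (\<exists>\<alpha>::scalar_field. \<forall>x\<in>M. rank (ricci g x - \<alpha> x *\<^sub>R g x) \<le> 2)"

definition pseudo_quasi_einstein_for ::
  "point set \<Rightarrow> metric \<Rightarrow> scalar_field \<Rightarrow> scalar_field \<Rightarrow> scalar_field \<Rightarrow> (point \<Rightarrow> tensor1) \<Rightarrow> bool"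
where
  \<comment> \<open>\<open>matrix_inv (g x) *v \<eta> x\<close> is the vector \<open>V\<close> associated with \<open>\<eta>\<close>\<close>
  "pseudo_quasi_einstein_for M g \<alpha> \<beta> \<gamma> \<eta> \<longleftrightarrow>
     (\<exists>E :: point \<Rightarrow> tensor2. \<forall>x\<in>M.
        ricci g x = \<alpha> x *\<^sub>R g x + \<beta> x *\<^sub>R form_prod (\<eta> x) (\<eta> x) + \<gamma> x *\<^sub>R E x \<and>
        metric_trace (g x) (E x) = 0 \<and>
        E x *v (matrix_inv (g x) *v \<eta> x) = 0)"

text \<open>
  The next two notions replace the tensor \<open>E\<close> of the decomposition by a specific expression;
  \<open>E\<close> is then not required to be trace-free (\<open>\<Phi> \<otimes> \<Phi>\<close> with \<open>\<Phi>\<close> of norm \<open>-1\<close> is not).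
\<close>

definition de_ghosh_for ::
  "point set \<Rightarrow> metric \<Rightarrow> scalar_field \<Rightarrow> scalar_field \<Rightarrow> scalar_field
     \<Rightarrow> (point \<Rightarrow> tensor1) \<Rightarrow> (point \<Rightarrow> tensor1) \<Rightarrow> bool"
where
  "de_ghosh_for M g \<alpha> \<beta> \<gamma> \<eta> \<Phi> \<longleftrightarrow>
     (\<forall>x\<in>M. ricci g x = \<alpha> x *\<^sub>R g x + \<beta> x *\<^sub>R form_prod (\<eta> x) (\<eta> x)
                        + \<gamma> x *\<^sub>R form_prod (\<Phi> x) (\<Phi> x))"

definition chaki_for ::
  "point set \<Rightarrow> metric \<Rightarrow> scalar_field \<Rightarrow> scalar_field \<Rightarrow> scalar_field
     \<Rightarrow> (point \<Rightarrow> tensor1) \<Rightarrow> (point \<Rightarrow> tensor1) \<Rightarrow> bool"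
where
  "chaki_for M g \<alpha> \<beta> \<gamma> \<eta> \<Phi> \<longleftrightarrow>
     (\<forall>x\<in>M. ricci g x = \<alpha> x *\<^sub>R g x + \<beta> x *\<^sub>R form_prod (\<eta> x) (\<eta> x)
                        + \<gamma> x *\<^sub>R (form_prod (\<eta> x) (\<Phi> x) + form_prod (\<Phi> x) (\<eta> x)))"

definition conformal_2_forms_recurrent ::
  "point set \<Rightarrow> metric \<Rightarrow> (point \<Rightarrow> tensor1) \<Rightarrow> bool" where
  "conformal_2_forms_recurrent M g \<eta> \<longleftrightarrow>
     (\<forall>x\<in>M. \<forall>i j k l m.
        nabla4 g (conformal g) x $ i $ j $ k $ l $ m
          + nabla4 g (conformal g) x $ j $ k $ i $ l $ m
          + nabla4 g (conformal g) x $ k $ i $ j $ l $ m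
        = \<eta> x $ i * conformal g x $ j $ k $ l $ m
          + \<eta> x $ j * conformal g x $ k $ i $ l $ m
          + \<eta> x $ k * conformal g x $ i $ j $ l $ m)"

definition raise2 :: "tensor2 \<Rightarrow> tensor2 \<Rightarrow> 4 \<Rightarrow> real^4" where
  \<comment> \<open>the vector \<open>\<E>\<partial>\<^sub>i\<close> with \<open>E(\<partial>\<^sub>i, \<partial>\<^sub>j) = G(\<E>\<partial>\<^sub>i, \<partial>\<^sub>j)\<close>\<close>
  "raise2 G E i = (\<chi> m. \<Sum>l\<in>UNIV. matrix_inv G $ m $ l * E $ i $ l)"

definition compatible ::
  "point set \<Rightarrow> metric \<Rightarrow> (point \<Rightarrow> tensor4) \<Rightarrow> (point \<Rightarrow> tensor2) \<Rightarrow> bool" where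
  "compatible M g D E \<longleftrightarrow>
     (\<forall>x\<in>M. \<forall>i j k l.
        (\<Sum>m\<in>UNIV. raise2 (g x) (E x) i $ m * D x $ m $ l $ j $ k
                 + raise2 (g x) (E x) j $ m * D x $ m $ l $ k $ i
                 + raise2 (g x) (E x) k $ m * D x $ m $ l $ i $ j) = 0)"

definition form_compatible ::
  "point set \<Rightarrow> metric \<Rightarrow> (point \<Rightarrow> tensor4) \<Rightarrow> (point \<Rightarrow> tensor1) \<Rightarrow> bool" where
  "form_compatible M g D \<eta> \<longleftrightarrow> compatible M g D (\<lambda>x. form_prod (\<eta> x) (\<eta> x))"


section \<open>The Robinson-Trautman metric\<close>

definition rt_metric :: "real \<Rightarrow> real \<Rightarrow> real \<Rightarrow> (real \<times> real \<Rightarrow> real) \<Rightarrow> metric" where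
  "rt_metric a b q f x =
     vector [vector [- 2 * (a - 2 * b * x$2 - q / x$2), 1, 0, 0],
             vector [1, 0, 0, 0],
             vector [0, 0, - ((x$2)\<^sup>2 / (f (x$3, x$4))\<^sup>2), 0],
             vector [0, 0, 0, - ((x$2)\<^sup>2 / (f (x$3, x$4))\<^sup>2)]]"

definition rt_F :: "(real \<times> real \<Rightarrow> real) \<Rightarrow> scalar_field" where
  "rt_F f x =
     (let h = (\<lambda>y. f (y$3, y$4))
      in (pdiff 3 h x)\<^sup>2 + (pdiff 4 h x)\<^sup>2
         - h x * (pdiff 3 (pdiff 3 h) x + pdiff 4 (pdiff 4 h) x))"

end

theory Submission
  imports Defs
begin

text \<open>
  The metric is a warped product \<open>g = h + k\<close> with two-dimensional base metric \<open>h\<close> (coordinates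
  \<open>t, r\<close>) and fibre metric \<open>k\<close> (coordinates \<open>x\<^sup>3, x\<^sup>4\<close>), so \<open>R\<close>, \<open>C\<close>, \<open>W\<close>, \<open>K\<close> are combinations
  \<open>\<alpha> h \<owedge> h + \<beta> h \<owedge> k + \<gamma> k \<owedge> k\<close> and \<open>S\<close> is a combination of \<open>h\<close> and \<open>k\<close>.
  Both \<open>D \<cdot> _\<close> and \<open>Q(g, _)\<close> are derivations. For such a combination \<open>D\<close> they satisfy
  \<open>D \<cdot> h = \<beta> Q(g, h)\<close> and \<open>D \<cdot> k = \<beta> Q(g, k)\<close>, hence \<open>D \<cdot> H = \<beta> Q(g, H)\<close> for every \<open>H\<close> built from
  \<open>h\<close> and \<open>k\<close>. As \<open>Q(h, h \<owedge> h) = 0\<close> and \<open>Q(k, h \<owedge> h) = - 2 Q(h, h \<owedge> k)\<close>, all tensors \<open>Q(A, H)\<close> lie in the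
  span of \<open>Q(h, h \<owedge> k)\<close> and \<open>Q(k, h \<owedge> k)\<close>, and the remaining pseudosymmetry identities reduce to
  pairs of scalar identities. The conformal tensor is
  a scalar multiple of \<open>- h \<owedge> h + h \<owedge> k - k \<owedge> k\<close>, so its covariant derivative follows from
  \<open>(\<nabla>\<^sub>X h)(Y, Z) = (k(X, Y) dr(Z) + k(X, Z) dr(Y)) / r\<close>.
\<close>

section \<open>Algebra of block tensors\<close>

lemma vector_4 [simp]:
  fixes x :: "'a::zero"
  shows "(vector [x,y,z,w] :: 'a^4) $ 1 = x" "(vector [x,y,z,w] :: 'a^4) $ 2 = y"
    "(vector [x,y,z,w] :: 'a^4) $ 3 = z" "(vector [x,y,z,w] :: 'a^4) $ 4 = w"
  unfolding vector_def by simp_all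

section \<open>The operators \<open>dot4\<close> and \<open>tachibana4\<close> as linear
  derivations\<close>

lemma tachibana4_add_left: "tachibana4 (A + B) H = tachibana4 A H + tachibana4 B H"
  by (simp add: tachibana4_def vec_eq_iff algebra_simps)

lemma tachibana4_add_right: "tachibana4 A (H + H') = tachibana4 A H + tachibana4 A H'"
  by (simp add: tachibana4_def vec_eq_iff algebra_simps)

lemma tachibana4_scaleR_left: "tachibana4 (c *\<^sub>R A) H = c *\<^sub>R tachibana4 A H"
  by (simp add: tachibana4_def vec_eq_iff algebra_simps)

lemma tachibana4_scaleR_right: "tachibana4 A (c *\<^sub>R H) = c *\<^sub>R tachibana4 A H"
  by (simp add: tachibana4_def vec_eq_iff algebra_simps)

lemma dot4_add: "dot4 G D (H + H') = dot4 G D H + dot4 G D H'"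
  by (simp add: dot4_def vec_eq_iff algebra_simps sum.distrib)

lemma dot4_scaleR: "dot4 G D (c *\<^sub>R H) = c *\<^sub>R dot4 G D H"
  by (simp add: dot4_def vec_eq_iff algebra_simps sum_distrib_left)

text \<open>With \<open>G\<close>, \<open>D\<close> and \<open>L\<close> fixed, pseudosymmetry is a
  linear condition on the remaining tensor. As predicates, these conditions can be carried step by
  step through sums, multiples and products.\<close>

definition pseudosym2 :: "tensor2 \<Rightarrow> tensor4 \<Rightarrow> real \<Rightarrow> tensor2 \<Rightarrow> bool" where
  "pseudosym2 G D L A \<longleftrightarrow> dot2 G D A = L *\<^sub>R tachibana2 G A"

definition pseudosym4 :: "tensor2 \<Rightarrow> tensor4 \<Rightarrow> real \<Rightarrow> tensor4 \<Rightarrow> bool" where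
  "pseudosym4 G D L H \<longleftrightarrow> dot4 G D H = L *\<^sub>R tachibana4 G H"

lemma pseudosym4_add:
  "pseudosym4 G D L H \<Longrightarrow> pseudosym4 G D L H' \<Longrightarrow> pseudosym4 G D L (H + H')"
  by (simp add: pseudosym4_def dot4_add tachibana4_add_right scaleR_add_right)

lemma pseudosym4_scaleR: "pseudosym4 G D L H \<Longrightarrow> pseudosym4 G D L (c *\<^sub>R H)"
  by (simp add: pseudosym4_def dot4_scaleR tachibana4_scaleR_right)

lemma pseudosym4_diff:
  "pseudosym4 G D L H \<Longrightarrow> pseudosym4 G D L H' \<Longrightarrow> pseudosym4 G D L (H - H')"
  using pseudosym4_add[of G D L H "(-1) *\<^sub>R H'"] pseudosym4_scaleR[of G D L H' "-1"] by simp

lemma pseudosym2_add: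
  "pseudosym2 G D L A \<Longrightarrow> pseudosym2 G D L A' \<Longrightarrow> pseudosym2 G D L (A + A')"
  by (simp add: pseudosym2_def dot2_def tachibana2_def vec_eq_iff algebra_simps sum.distrib)

lemma pseudosym2_scaleR: 
  assumes "pseudosym2 G D L A" shows "pseudosym2 G D L (c *\<^sub>R A)"
proof -
  have "dot2 G D (c *\<^sub>R A) = c *\<^sub>R dot2 G D A"
    by (simp add: dot2_def vec_eq_iff algebra_simps sum_distrib_left)
  moreover have "tachibana2 G (c *\<^sub>R A) = c *\<^sub>R tachibana2 G A"
    by (simp add: tachibana2_def vec_eq_iff algebra_simps)
  ultimately show ?thesis using assms by (simp add: pseudosym2_def)
qed

text \<open>The slots are paired 1-4 and 2-3, as in the first term of the Kulkarni-Nomizu product.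
  The other three terms arise by exchanging the factors and the first two slots.\<close>

definition outer_prod :: "tensor2 \<Rightarrow> tensor2 \<Rightarrow> tensor4" where
  "outer_prod A B = (\<chi> i j k l. A $ i $ l * B $ j $ k)"

definition swap12 :: "tensor4 \<Rightarrow> tensor4" where
  "swap12 H = (\<chi> i j k l. H $ j $ i $ k $ l)"

lemma kulkarni_nomizu_outer_prod:
  "A \<owedge> B = outer_prod A B + outer_prod B A - swap12 (outer_prod B A) - swap12 (outer_prod A B)"
  by (simp add: kulkarni_nomizu_def outer_prod_def swap12_def vec_eq_iff)

text \<open>Leibniz rule: both operators act on a product one factor at a time, and on each factor
  they agree up to the common scalar \<open>L\<close>.\<close>

lemma pseudosym4_outer_prod:
  assumes "pseudosym2 G D L A" "pseudosym2 G D L B"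
  shows "pseudosym4 G D L (outer_prod A B)"
proof -
  have "dot4 G D (outer_prod A B) $ i $ j $ k $ l $ x $ y
        = dot2 G D A $ i $ l $ x $ y * B $ j $ k + A $ i $ l * dot2 G D B $ j $ k $ x $ y"
    for i j k l x y
    by (simp add: dot4_def dot2_def outer_prod_def sum.distrib sum_distrib_left sum_distrib_right
        algebra_simps)
  moreover have "tachibana4 G (outer_prod A B) $ i $ j $ k $ l $ x $ y
        = tachibana2 G A $ i $ l $ x $ y * B $ j $ k + A $ i $ l * tachibana2 G B $ j $ k $ x $ y"
    for i j k l x y
    by (simp add: tachibana4_def tachibana2_def outer_prod_def algebra_simps)
  ultimately show ?thesis
    using assms by (simp add: pseudosym4_def pseudosym2_def vec_eq_iff algebra_simps)
qed

text \<open>Both operators treat all slots of the tensor alike, so they commute with an exchange of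
  two slots.\<close>

lemma pseudosym4_swap12:
  assumes "pseudosym4 G D L H"
  shows "pseudosym4 G D L (swap12 H)"
proof -
  have "dot4 G D (swap12 H) $ i $ j $ k $ l $ x $ y = dot4 G D H $ j $ i $ k $ l $ x $ y"
    for i j k l x y
    by (simp add: dot4_def swap12_def algebra_simps)
  moreover have "tachibana4 G (swap12 H) $ i $ j $ k $ l $ x $ y
      = tachibana4 G H $ j $ i $ k $ l $ x $ y"
    for i j k l x y
    by (simp add: tachibana4_def swap12_def algebra_simps)
  ultimately show ?thesis
    using assms by (simp add: pseudosym4_def vec_eq_iff)
qed

lemma pseudosym4_kulkarni_nomizu:
  "pseudosym2 G D L A \<Longrightarrow> pseudosym2 G D L B \<Longrightarrow> pseudosym4 G D L (A \<owedge> B)"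
  unfolding kulkarni_nomizu_outer_prod
  by (intro pseudosym4_add pseudosym4_diff pseudosym4_outer_prod pseudosym4_swap12)

section \<open>Kulkarni-Nomizu products and Tachibana tensors of two symmetric forms\<close>

lemma kulkarni_nomizu_commute: "A \<owedge> B = B \<owedge> A"
  by (simp add: kulkarni_nomizu_def vec_eq_iff)

lemma kulkarni_nomizu_add_left: "(A + B) \<owedge> E = A \<owedge> E + B \<owedge> E"
  by (simp add: kulkarni_nomizu_def vec_eq_iff algebra_simps)

lemma kulkarni_nomizu_scaleR_left: "(c *\<^sub>R A) \<owedge> E = c *\<^sub>R (A \<owedge> E)"
  by (simp add: kulkarni_nomizu_def vec_eq_iff algebra_simps)

lemma kulkarni_nomizu_add_right: "E \<owedge> (A + B) = E \<owedge> A + E \<owedge> B"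
  by (simp add: kulkarni_nomizu_def vec_eq_iff algebra_simps)

lemma kulkarni_nomizu_scaleR_right: "E \<owedge> (c *\<^sub>R A) = c *\<^sub>R (E \<owedge> A)"
  by (simp add: kulkarni_nomizu_def vec_eq_iff algebra_simps)

text \<open>\<open>Q(h, _)\<close> is a derivation, and symmetry of \<open>h\<close> gives
  \<open>Q(h, h) = 0\<close> on (0,2)-tensors.\<close>

lemma tachibana4_square_self:
  assumes "\<And>i j. h $ i $ j = h $ j $ i"
  shows "tachibana4 h (h \<owedge> h) = 0"
  by (simp add: tachibana4_def kulkarni_nomizu_def vec_eq_iff algebra_simps assms)

text \<open>Polarisation of \<open>Q(A, A \<owedge> A) = 0\<close>: this is the coefficient of
  \<open>s\<close> for \<open>A = h + s k\<close>.\<close>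

lemma tachibana4_square_other:
  assumes h: "\<And>i j. h $ i $ j = h $ j $ i" and k: "\<And>i j. k $ i $ j = k $ j $ i"
  shows "tachibana4 k (h \<owedge> h) = (-2) *\<^sub>R tachibana4 h (h \<owedge> k)"
  by (simp add: tachibana4_def kulkarni_nomizu_def vec_eq_iff algebra_simps assms)

text \<open>\<open>block_tensor h k \<alpha> \<beta> \<gamma>\<close> is the general shape of the curvature tensors of a warped product
  with two-dimensional base metric \<open>h\<close> and fibre metric \<open>k\<close>.\<close>

definition block_tensor :: "tensor2 \<Rightarrow> tensor2 \<Rightarrow> real \<Rightarrow> real \<Rightarrow> real \<Rightarrow> tensor4" where
  "block_tensor h k \<alpha> \<beta> \<gamma> = \<alpha> *\<^sub>R (h \<owedge> h) + \<beta> *\<^sub>R (h \<owedge> k) + \<gamma> *\<^sub>R (k \<owedge> k)"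

lemma block_tensor_add:
  "block_tensor h k \<alpha> \<beta> \<gamma> + block_tensor h k \<alpha>' \<beta>' \<gamma>' = block_tensor h k (\<alpha> + \<alpha>') (\<beta> + \<beta>') (\<gamma> + \<gamma>')"
  by (simp add: block_tensor_def algebra_simps)

lemma block_tensor_diff:
  "block_tensor h k \<alpha> \<beta> \<gamma> - block_tensor h k \<alpha>' \<beta>' \<gamma>' = block_tensor h k (\<alpha> - \<alpha>') (\<beta> - \<beta>') (\<gamma> - \<gamma>')"
  by (simp add: block_tensor_def algebra_simps)

lemma block_tensor_scaleR:
  "c *\<^sub>R block_tensor h k \<alpha> \<beta> \<gamma> = block_tensor h k (c * \<alpha>) (c * \<beta>) (c * \<gamma>)"
  by (simp add: block_tensor_def algebra_simps)

lemma kulkarni_nomizu_block: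
  "(s *\<^sub>R h + u *\<^sub>R k) \<owedge> (s' *\<^sub>R h + u' *\<^sub>R k) = block_tensor h k (s * s') (s * u' + u * s') (u * u')"
  by (simp add: block_tensor_def kulkarni_nomizu_add_left kulkarni_nomizu_scaleR_left
      kulkarni_nomizu_add_right kulkarni_nomizu_scaleR_right kulkarni_nomizu_commute[of k h]
      algebra_simps)

text \<open>Bilinear expansion produces six tensors; two vanish and two are multiples of the
  remaining pair. Identities among Tachibana tensors thus follow from pairs of scalar
  equations.\<close>

lemma tachibana4_block:
  assumes h: "\<And>i j. h $ i $ j = h $ j $ i" and k: "\<And>i j. k $ i $ j = k $ j $ i"
  shows "tachibana4 (s *\<^sub>R h + u *\<^sub>R k) (block_tensor h k \<alpha> \<beta> \<gamma>)
    = (s * \<beta> - 2 * u * \<alpha>) *\<^sub>R tachibana4 h (h \<owedge> k)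
      + (u * \<beta> - 2 * s * \<gamma>) *\<^sub>R tachibana4 k (h \<owedge> k)"
proof -
  have *: "tachibana4 h (k \<owedge> k) = (-2) *\<^sub>R tachibana4 k (h \<owedge> k)"
    using tachibana4_square_other[OF k h] by (simp add: kulkarni_nomizu_commute)
  show ?thesis
    by (simp add: block_tensor_def tachibana4_add_left tachibana4_add_right tachibana4_scaleR_left
        tachibana4_scaleR_right tachibana4_square_self h k tachibana4_square_other[OF h k] *
        algebra_simps)
qed

text \<open>The four product equations make \<open>matrix_inv G ** h\<close> and
  \<open>matrix_inv G ** k\<close> idempotent with vanishing products: they are the projections to
  base and fibre.\<close>

locale metric_splitting =
  fixes h k G :: tensor2
  assumes sym_h: "h $ i $ j = h $ j $ i" and sym_k: "k $ i $ j = k $ j $ i"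
    and G_eq: "G = h + k"
    and sym_inv: "matrix_inv G $ i $ j = matrix_inv G $ j $ i"
    and hh: "h ** matrix_inv G ** h = h" and hk: "h ** matrix_inv G ** k = 0"
    and kh: "k ** matrix_inv G ** h = 0" and kk: "k ** matrix_inv G ** k = k"
begin

text \<open>Once the contraction is written with products \<open>X ** matrix_inv G ** E\<close>, the
  four splitting equations evaluate it.\<close>

lemma raise4_kulkarni_nomizu_contract:
  "(\<Sum>m\<in>UNIV. raise4 G (A \<owedge> B) x y i $ m * E $ m $ j)
   = (A ** matrix_inv G ** E) $ x $ j * B $ y $ i + A $ y $ i * (B ** matrix_inv G ** E) $ x $ j
     - A $ x $ i * (B ** matrix_inv G ** E) $ y $ j - (A ** matrix_inv G ** E) $ y $ j * B $ x $ i"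
proof -
  have *: "(X ** matrix_inv G ** E) $ z $ j
    = (\<Sum>m\<in>UNIV. \<Sum>l\<in>UNIV. matrix_inv G $ m $ l * X $ z $ l * E $ m $ j)" for X z
    by (simp add: matrix_matrix_mult_def sum_distrib_left sum_distrib_right sym_inv algebra_simps)
  show ?thesis
    unfolding *
    by (simp add: raise4_def kulkarni_nomizu_def sum_distrib_left sum_distrib_right
        sum.distrib sum_subtractf algebra_simps)
qed

lemma raise4_add: "raise4 G (D + D') x y i = raise4 G D x y i + raise4 G D' x y i"
  by (simp add: raise4_def vec_eq_iff sum.distrib algebra_simps)

lemma raise4_scaleR: "raise4 G (c *\<^sub>R D) x y i = c *\<^sub>R raise4 G D x y i"
  by (simp add: raise4_def vec_eq_iff sum_distrib_left algebra_simps)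

text \<open>\<open>\<gamma>\<close> disappears because the raised \<open>k\<close> contracts to zero
  with \<open>h\<close>.\<close>

lemma raise4_block_contract_base:
  "(\<Sum>m\<in>UNIV. raise4 G (block_tensor h k \<alpha> \<beta> \<gamma>) x y i $ m * h $ m $ j)
   = 2 * \<alpha> * (h $ x $ j * h $ y $ i - h $ x $ i * h $ y $ j)
     + \<beta> * (h $ x $ j * k $ y $ i - k $ x $ i * h $ y $ j)"
proof -
  have "(\<Sum>m\<in>UNIV. raise4 G (block_tensor h k \<alpha> \<beta> \<gamma>) x y i $ m * h $ m $ j)
    = \<alpha> * (\<Sum>m\<in>UNIV. raise4 G (h \<owedge> h) x y i $ m * h $ m $ j)
    + \<beta> * (\<Sum>m\<in>UNIV. raise4 G (h \<owedge> k) x y i $ m * h $ m $ j)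
    + \<gamma> * (\<Sum>m\<in>UNIV. raise4 G (k \<owedge> k) x y i $ m * h $ m $ j)"
    by (simp add: block_tensor_def raise4_add raise4_scaleR sum_distrib_left sum.distrib algebra_simps)
  then show ?thesis
    unfolding raise4_kulkarni_nomizu_contract hh hk kh kk by (simp add: algebra_simps)
qed

lemma raise4_block_contract_fibre:
  "(\<Sum>m\<in>UNIV. raise4 G (block_tensor h k \<alpha> \<beta> \<gamma>) x y i $ m * k $ m $ j)
   = 2 * \<gamma> * (k $ x $ j * k $ y $ i - k $ x $ i * k $ y $ j)
     + \<beta> * (k $ x $ j * h $ y $ i - h $ x $ i * k $ y $ j)"
proof -
  have "(\<Sum>m\<in>UNIV. raise4 G (block_tensor h k \<alpha> \<beta> \<gamma>) x y i $ m * k $ m $ j)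
    = \<alpha> * (\<Sum>m\<in>UNIV. raise4 G (h \<owedge> h) x y i $ m * k $ m $ j)
    + \<beta> * (\<Sum>m\<in>UNIV. raise4 G (h \<owedge> k) x y i $ m * k $ m $ j)
    + \<gamma> * (\<Sum>m\<in>UNIV. raise4 G (k \<owedge> k) x y i $ m * k $ m $ j)"
    by (simp add: block_tensor_def raise4_add raise4_scaleR sum_distrib_left sum.distrib algebra_simps)
  then show ?thesis
    unfolding raise4_kulkarni_nomizu_contract hh hk kh kk by (simp add: algebra_simps)
qed

lemma dot2_sym:
  assumes "\<And>i j. A $ i $ j = A $ j $ i"
  shows "dot2 G D A $ i $ j $ x $ y
    = - (\<Sum>m\<in>UNIV. raise4 G D x y i $ m * A $ m $ j) - (\<Sum>m\<in>UNIV. raise4 G D x y j $ m * A $ m $ i)"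
  using assms by (simp add: dot2_def sum.distrib)

lemma G_nth: "G $ i $ j = h $ i $ j + k $ i $ j"
  by (simp add: G_eq)

text \<open>The \<open>\<alpha>\<close> part of the contraction is skew in the two slots of
  \<open>h\<close> and cancels in \<open>dot2\<close>. On the other side only the summand
  \<open>k\<close> of \<open>G\<close> survives. What remains is the mixed term with factor
  \<open>\<beta>\<close>.\<close>

lemma pseudosym2_base: "pseudosym2 G (block_tensor h k \<alpha> \<beta> \<gamma>) \<beta> h"
  unfolding pseudosym2_def vec_eq_iff
  unfolding dot2_sym[OF sym_h] raise4_block_contract_base
  by (simp add: tachibana2_def G_nth sym_h sym_k algebra_simps)

lemma pseudosym2_fibre: "pseudosym2 G (block_tensor h k \<alpha> \<beta> \<gamma>) \<beta> k"
  unfolding pseudosym2_def vec_eq_iff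
  unfolding dot2_sym[OF sym_k] raise4_block_contract_fibre
  by (simp add: tachibana2_def G_nth sym_h sym_k algebra_simps)

lemma pseudosym2_block:
  "pseudosym2 G (block_tensor h k \<alpha> \<beta> \<gamma>) \<beta> (s *\<^sub>R h + u *\<^sub>R k)"
  by (intro pseudosym2_add pseudosym2_scaleR pseudosym2_base pseudosym2_fibre)

lemma pseudosym4_block:
  "pseudosym4 G (block_tensor h k \<alpha> \<beta> \<gamma>) \<beta> (block_tensor h k \<alpha>' \<beta>' \<gamma>')"
  unfolding block_tensor_def[of h k \<alpha>' \<beta>' \<gamma>']
  by (intro pseudosym4_add pseudosym4_scaleR pseudosym4_kulkarni_nomizu
      pseudosym2_base pseudosym2_fibre)

text \<open>Contraction with the block tensor leaves only the two forms assumed symmetric, which are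
  \<open>E\<close> with its second slot projected to base or fibre. Their symmetry makes the cyclic
  sum cancel in pairs.\<close>

lemma block_compatible:
  assumes h: "\<And>i j. (E ** matrix_inv G ** h) $ i $ j = (E ** matrix_inv G ** h) $ j $ i"
    and k: "\<And>i j. (E ** matrix_inv G ** k) $ i $ j = (E ** matrix_inv G ** k) $ j $ i"
  shows "(\<Sum>m\<in>UNIV. raise2 G E i $ m * block_tensor h k \<alpha> \<beta> \<gamma> $ m $ l $ j $ n
                 + raise2 G E j $ m * block_tensor h k \<alpha> \<beta> \<gamma> $ m $ l $ n $ i
                 + raise2 G E n $ m * block_tensor h k \<alpha> \<beta> \<gamma> $ m $ l $ i $ j) = 0"
proof -
  have *: "(\<Sum>m\<in>UNIV. raise2 G E i $ m * X $ m $ j) = (E ** matrix_inv G ** X) $ i $ j" for X :: tensor2 and i j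
    by (simp add: matrix_matrix_mult_def raise2_def sum_distrib_right sym_inv algebra_simps)
  have **: "(\<Sum>m\<in>UNIV. raise2 G E i $ m * block_tensor h k \<alpha> \<beta> \<gamma> $ m $ l $ j $ n)
    = (let eh = \<lambda>i j. (E ** matrix_inv G ** h) $ i $ j; ek = \<lambda>i j. (E ** matrix_inv G ** k) $ i $ j in
      2 * \<alpha> * (eh i n * h $ l $ j - eh i j * h $ l $ n)
      + \<beta> * (eh i n * k $ l $ j + h $ l $ j * ek i n - eh i j * k $ l $ n - h $ l $ n * ek i j)
      + 2 * \<gamma> * (ek i n * k $ l $ j - ek i j * k $ l $ n))" for i j n
    unfolding Let_def *[symmetric]
    by (simp add: block_tensor_def kulkarni_nomizu_def sum_distrib_left sum_distrib_right
        sum.distrib sum_subtractf algebra_simps)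
  show ?thesis
    by (simp add: sum.distrib ** Let_def h k algebra_simps)
qed

end

section \<open>Partial derivatives and symmetry of second derivatives\<close>

lemma has_real_derivative_along_line:
  fixes u :: "'a::real_normed_vector \<Rightarrow> real"
  assumes "u differentiable (at (z + t *\<^sub>R v))"
  shows "((\<lambda>t. u (z + t *\<^sub>R v)) has_real_derivative frechet_derivative u (at (z + t *\<^sub>R v)) v) (at t)"
proof -
  let ?D = "frechet_derivative u (at (z + t *\<^sub>R v))"
  have D: "(u has_derivative ?D) (at (z + t *\<^sub>R v))"
    using assms by (simp add: frechet_derivative_works)
  have "((\<lambda>t. z + t *\<^sub>R v) has_derivative (\<lambda>t. t *\<^sub>R v)) (at t)"
    by (auto intro!: derivative_eq_intros)
  from has_derivative_compose[OF this D]
  have "((\<lambda>t. u (z + t *\<^sub>R v)) has_derivative (\<lambda>t. ?D (t *\<^sub>R v))) (at t)" .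
  moreover have "?D (t *\<^sub>R v) = t * ?D v" for t
    using linear_scale[OF has_derivative_linear[OF D], of t v] by simp
  then have "(*) (?D v) = (\<lambda>t. ?D (t *\<^sub>R v))"
    by (simp add: fun_eq_iff mult.commute)
  ultimately show ?thesis
    by (simp add: has_field_derivative_def)
qed

text \<open>The mean value theorem is applied twice: along \<open>v\<close> to a difference taken in
  direction \<open>w\<close>, then along \<open>w\<close> to the derivative in direction
  \<open>v\<close>. The second difference itself is symmetric in \<open>v\<close> and
  \<open>w\<close>.\<close>

lemma mixed_difference_mvt:
  fixes u :: "'a::real_normed_vector \<Rightarrow> real"
  assumes "s > 0"
    and U: "\<And>\<xi> \<eta>. 0 \<le> \<xi> \<Longrightarrow> \<xi> \<le> s \<Longrightarrow> 0 \<le> \<eta> \<Longrightarrow> \<eta> \<le> s \<Longrightarrow> z + \<xi> *\<^sub>R v + \<eta> *\<^sub>R w \<in> U"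
    and d1: "\<And>x. x \<in> U \<Longrightarrow> u differentiable (at x)"
    and d2: "\<And>x. x \<in> U \<Longrightarrow> (\<lambda>y. frechet_derivative u (at y) v) differentiable (at x)"
  obtains \<xi> \<eta> where "0 \<le> \<xi>" "\<xi> \<le> s" "0 \<le> \<eta>" "\<eta> \<le> s"
    "u (z + s *\<^sub>R v + s *\<^sub>R w) - u (z + s *\<^sub>R v) - u (z + s *\<^sub>R w) + u z
     = s\<^sup>2 * frechet_derivative (\<lambda>y. frechet_derivative u (at y) v) (at (z + \<xi> *\<^sub>R v + \<eta> *\<^sub>R w)) w"
proof -
  let ?D = "\<lambda>y. frechet_derivative u (at y) v"
  have "((\<lambda>t. u (z + t *\<^sub>R v + s *\<^sub>R w) - u (z + t *\<^sub>R v)) has_real_derivative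
      ?D (z + t *\<^sub>R v + s *\<^sub>R w) - ?D (z + t *\<^sub>R v)) (at t)" if "0 \<le> t" "t \<le> s" for t
  proof (rule DERIV_diff)
    show "((\<lambda>t. u (z + t *\<^sub>R v + s *\<^sub>R w)) has_real_derivative ?D (z + t *\<^sub>R v + s *\<^sub>R w)) (at t)"
      using has_real_derivative_along_line[of u "z + s *\<^sub>R w" t v] d1[OF U[of t s]] that \<open>s > 0\<close>
      by (simp add: algebra_simps)
    show "((\<lambda>t. u (z + t *\<^sub>R v)) has_real_derivative ?D (z + t *\<^sub>R v)) (at t)"
      using has_real_derivative_along_line[of u z t v] d1[OF U[of t 0]] that \<open>s > 0\<close> by simp
  qed
  from MVT2[OF \<open>s > 0\<close> this] obtain \<xi> where \<xi>: "0 < \<xi>" "\<xi> < s" and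
    eq1: "u (z + s *\<^sub>R v + s *\<^sub>R w) - u (z + s *\<^sub>R v) - (u (z + s *\<^sub>R w) - u z)
      = s * (?D (z + \<xi> *\<^sub>R v + s *\<^sub>R w) - ?D (z + \<xi> *\<^sub>R v))"
    by auto
  have "((\<lambda>t. ?D (z + \<xi> *\<^sub>R v + t *\<^sub>R w)) has_real_derivative
      frechet_derivative ?D (at (z + \<xi> *\<^sub>R v + t *\<^sub>R w)) w) (at t)" if "0 \<le> t" "t \<le> s" for t
    using has_real_derivative_along_line[of ?D "z + \<xi> *\<^sub>R v" t w] d2[OF U[of \<xi> t]] that \<xi> by simp
  from MVT2[OF \<open>s > 0\<close> this] obtain \<eta> where \<eta>: "0 < \<eta>" "\<eta> < s" and
    eq2: "?D (z + \<xi> *\<^sub>R v + s *\<^sub>R w) - ?D (z + \<xi> *\<^sub>R v)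
      = s * frechet_derivative ?D (at (z + \<xi> *\<^sub>R v + \<eta> *\<^sub>R w)) w"
    by auto
  show ?thesis
    using that[of \<xi> \<eta>] \<xi> \<eta> eq1 eq2 by (simp add: power2_eq_square algebra_simps)
qed

lemma smooth_on_differentiable: "smooth_on U u \<Longrightarrow> x \<in> U \<Longrightarrow> u differentiable (at x)"
  unfolding smooth_on_def by (metis times_differentiable_on.simps(2))

lemma smooth_on_frechet_derivative:
  "smooth_on U u \<Longrightarrow> smooth_on U (\<lambda>x. frechet_derivative u (at x) v)"
  unfolding smooth_on_def by (metis times_differentiable_on.simps(2))

lemma smooth_on_continuous: "smooth_on U u \<Longrightarrow> continuous_on U u"
  unfolding smooth_on_def by (metis times_differentiable_on.simps(1))

text \<open>Schwarz's theorem: computing one second difference in both orders shows that the two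
  mixed derivatives take equal values at two points near \<open>z\<close>; continuity carries the
  equality to \<open>z\<close>.\<close>

lemma smooth_on_mixed_derivatives:
  fixes u :: "'a::real_normed_vector \<Rightarrow> real"
  assumes smooth: "smooth_on U u" and "open U" "z \<in> U"
  shows "frechet_derivative (\<lambda>x. frechet_derivative u (at x) v) (at z) w
    = frechet_derivative (\<lambda>x. frechet_derivative u (at x) w) (at z) v"
proof -
  define A where "A v w z = frechet_derivative (\<lambda>x. frechet_derivative u (at x) v) (at z) w" for v w z
  have cont: "isCont (A v w) z" for v w
    unfolding A_def using smooth_on_continuous[OF smooth_on_frechet_derivative[OF
        smooth_on_frechet_derivative[OF smooth]]] assms continuous_on_eq_continuous_at by blast
  have "\<bar>A v w z - A w v z\<bar> \<le> e" if "e > 0" for e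
  proof -
    have "\<forall>\<^sub>F y in nhds z. \<bar>A v w y - A v w z\<bar> < e/2"
      using tendstoD[OF cont[of v w, unfolded continuous_at tendsto_at_iff_tendsto_nhds], of "e/2"] \<open>e > 0\<close>
      by (simp add: dist_real_def)
    moreover have "\<forall>\<^sub>F y in nhds z. \<bar>A w v y - A w v z\<bar> < e/2"
      using tendstoD[OF cont[of w v, unfolded continuous_at tendsto_at_iff_tendsto_nhds], of "e/2"] \<open>e > 0\<close>
      by (simp add: dist_real_def)
    moreover have "\<forall>\<^sub>F y in nhds z. y \<in> U"
      using assms eventually_nhds by blast
    ultimately have "\<forall>\<^sub>F y in nhds z. y \<in> U \<and> \<bar>A v w y - A v w z\<bar> < e/2 \<and> \<bar>A w v y - A w v z\<bar> < e/2"
      by eventually_elim auto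
    then obtain \<delta> where "\<delta> > 0" and
      \<delta>: "\<And>y. dist y z < \<delta> \<Longrightarrow> y \<in> U \<and> \<bar>A v w y - A v w z\<bar> < e/2 \<and> \<bar>A w v y - A w v z\<bar> < e/2"
      unfolding eventually_nhds_metric by blast
    \<comment> \<open>The summand 1 keeps the denominator positive when both vectors vanish and
      makes the distance bound strict.\<close>
    define s where "s = \<delta> / (norm v + norm w + 1)"
    have pos: "norm v + norm w + 1 > 0"
      by (smt (verit) norm_ge_zero)
    have "s > 0"
      using \<open>\<delta> > 0\<close> pos by (simp add: s_def)
    \<comment> \<open>The set equation admits both orders of the two directions.\<close>
    have near: "dist (z + \<xi> *\<^sub>R v' + \<eta> *\<^sub>R w') z < \<delta>"
      if "0 \<le> \<xi>" "\<xi> \<le> s" "0 \<le> \<eta>" "\<eta> \<le> s" "{v', w'} = {v, w}" for \<xi> \<eta> v' w'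
    proof -
      have "norm (\<xi> *\<^sub>R v' + \<eta> *\<^sub>R w') \<le> \<xi> * norm v' + \<eta> * norm w'"
        using norm_triangle_ineq[of "\<xi> *\<^sub>R v'" "\<eta> *\<^sub>R w'"] that by simp
      also have "\<dots> \<le> s * norm v' + s * norm w'"
        using that by (intro add_mono mult_right_mono) auto
      also have "\<dots> = s * (norm v + norm w)"
        using that by (auto simp: doubleton_eq_iff algebra_simps)
      also have "\<dots> < s * (norm v + norm w + 1)"
        using \<open>s > 0\<close> by simp
      also have "\<dots> = \<delta>"
        using pos by (simp add: s_def)
      finally show ?thesis
        by (simp add: dist_norm add.assoc)
    qed
    have d: "u differentiable (at x)" "(\<lambda>y. frechet_derivative u (at y) v') differentiable (at x)"
      if "x \<in> U" for x v'
      using that smooth smooth_on_differentiable smooth_on_frechet_derivative by blast+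
    have box: "z + \<xi> *\<^sub>R v' + \<eta> *\<^sub>R w' \<in> U"
      if "0 \<le> \<xi>" "\<xi> \<le> s" "0 \<le> \<eta>" "\<eta> \<le> s" "{v', w'} = {v, w}" for \<xi> \<eta> v' w'
      using \<delta>[OF near[OF that]] by blast
    obtain \<xi> \<eta> where 1: "0 \<le> \<xi>" "\<xi> \<le> s" "0 \<le> \<eta>" "\<eta> \<le> s"
      "u (z + s *\<^sub>R v + s *\<^sub>R w) - u (z + s *\<^sub>R v) - u (z + s *\<^sub>R w) + u z
        = s\<^sup>2 * A v w (z + \<xi> *\<^sub>R v + \<eta> *\<^sub>R w)"
      unfolding A_def
      by (rule mixed_difference_mvt[OF \<open>s > 0\<close> box[of _ _ v w] d(1) d(2)[of _ v]]) auto
    obtain \<xi>' \<eta>' where 2: "0 \<le> \<xi>'" "\<xi>' \<le> s" "0 \<le> \<eta>'" "\<eta>' \<le> s"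
      "u (z + s *\<^sub>R w + s *\<^sub>R v) - u (z + s *\<^sub>R w) - u (z + s *\<^sub>R v) + u z
        = s\<^sup>2 * A w v (z + \<xi>' *\<^sub>R w + \<eta>' *\<^sub>R v)"
      unfolding A_def
      by (rule mixed_difference_mvt[OF \<open>s > 0\<close> box[of _ _ w v] d(1) d(2)[of _ w]]) auto
    have "s\<^sup>2 * A v w (z + \<xi> *\<^sub>R v + \<eta> *\<^sub>R w) = s\<^sup>2 * A w v (z + \<xi>' *\<^sub>R w + \<eta>' *\<^sub>R v)"
      using 1(5) 2(5) by (simp add: algebra_simps)
    then have "A v w (z + \<xi> *\<^sub>R v + \<eta> *\<^sub>R w) = A w v (z + \<xi>' *\<^sub>R w + \<eta>' *\<^sub>R v)"
      using \<open>s > 0\<close> by simp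
    moreover have "\<bar>A v w (z + \<xi> *\<^sub>R v + \<eta> *\<^sub>R w) - A v w z\<bar> < e/2"
      using \<delta>[OF near[of \<xi> \<eta> v w]] 1 by auto
    moreover have "\<bar>A w v (z + \<xi>' *\<^sub>R w + \<eta>' *\<^sub>R v) - A w v z\<bar> < e/2"
      using \<delta>[OF near[of \<xi>' \<eta>' w v]] 2 by auto
    ultimately show ?thesis by linarith
  qed
  then have "\<bar>A v w z - A w v z\<bar> \<le> 0"
    by (rule field_le_epsilon) simp
  then show ?thesis
    by (simp add: A_def)
qed

text \<open>\<open>pdiff\<close> is total and says nothing about differentiability. The relation
  includes it, so that the differentiation rules compose.\<close>

definition has_pdiff :: "4 \<Rightarrow> scalar_field \<Rightarrow> real \<Rightarrow> point \<Rightarrow> bool" where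
  "has_pdiff i u d x \<longleftrightarrow> ((\<lambda>s. u (x + s *\<^sub>R axis i 1)) has_real_derivative d) (at 0)"

lemma pdiff_eqI: "has_pdiff i u d x \<Longrightarrow> pdiff i u x = d"
  by (simp add: has_pdiff_def pdiff_def DERIV_imp_deriv)

lemma has_pdiff_eqI: "has_pdiff i u e x \<Longrightarrow> e = d \<Longrightarrow> has_pdiff i u d x"
  by simp

lemma has_pdiff_const: "has_pdiff i (\<lambda>y. c) 0 x"
  by (simp add: has_pdiff_def)

lemma pdiff_const [simp]: "pdiff i (\<lambda>y. c) x = 0"
  by (rule pdiff_eqI[OF has_pdiff_const])

lemma has_pdiff_coord: "has_pdiff i (\<lambda>y. y $ j) (axis i 1 $ j) x"
  unfolding has_pdiff_def by (auto intro!: derivative_eq_intros)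

lemma has_pdiff_add: "has_pdiff i u d x \<Longrightarrow> has_pdiff i v e x \<Longrightarrow> has_pdiff i (\<lambda>y. u y + v y) (d + e) x"
  unfolding has_pdiff_def by (rule DERIV_add)

lemma has_pdiff_minus: "has_pdiff i u d x \<Longrightarrow> has_pdiff i (\<lambda>y. - u y) (- d) x"
  unfolding has_pdiff_def by (rule DERIV_minus)

lemma has_pdiff_diff: "has_pdiff i u d x \<Longrightarrow> has_pdiff i v e x \<Longrightarrow> has_pdiff i (\<lambda>y. u y - v y) (d - e) x"
  unfolding has_pdiff_def by (rule DERIV_diff)

lemma has_pdiff_mult:
  "has_pdiff i u d x \<Longrightarrow> has_pdiff i v e x \<Longrightarrow> has_pdiff i (\<lambda>y. u y * v y) (d * v x + e * u x) x"
  unfolding has_pdiff_def using DERIV_mult by fastforce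

lemma has_pdiff_divide:
  "has_pdiff i u d x \<Longrightarrow> has_pdiff i v e x \<Longrightarrow> v x \<noteq> 0 \<Longrightarrow>
   has_pdiff i (\<lambda>y. u y / v y) ((d * v x - u x * e) / (v x * v x)) x"
  unfolding has_pdiff_def using DERIV_divide by fastforce

lemma has_pdiff_power:
  "has_pdiff i u d x \<Longrightarrow> has_pdiff i (\<lambda>y. u y ^ n) (real n * d * u x ^ (n - 1)) x"
  unfolding has_pdiff_def by (auto intro!: derivative_eq_intros)

text \<open>Each derivative value is left as an equation to prove, so the expected value may be
  given in any equal form.\<close>

lemmas has_pdiff_eq_intros = has_pdiff_const[THEN has_pdiff_eqI] has_pdiff_coord[THEN has_pdiff_eqI]
  has_pdiff_add[THEN has_pdiff_eqI] has_pdiff_minus[THEN has_pdiff_eqI]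
  has_pdiff_diff[THEN has_pdiff_eqI] has_pdiff_mult[THEN has_pdiff_eqI]
  has_pdiff_divide[THEN has_pdiff_eqI] has_pdiff_power[THEN has_pdiff_eqI]

text \<open>A short piece of the coordinate line through \<open>x\<close> stays in the open set
  \<open>M\<close>. Formulas valid only on \<open>M\<close> may therefore be differentiated.\<close>

lemma has_pdiff_transform:
  assumes "has_pdiff i u d x" "open M" "x \<in> M" "\<And>y. y \<in> M \<Longrightarrow> u y = v y"
  shows "has_pdiff i v d x"
proof -
  have "((\<lambda>s. x + s *\<^sub>R axis i 1) \<longlongrightarrow> x + 0 *\<^sub>R axis i 1) (nhds 0)"
    by (intro tendsto_intros filterlim_ident)
  then have "\<forall>\<^sub>F s::real in nhds 0. x + s *\<^sub>R axis i 1 \<in> M"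
    using assms(2,3) by (intro topological_tendstoD[of _ x]) auto
  then have "\<forall>\<^sub>F s::real in nhds 0. u (x + s *\<^sub>R axis i 1) = v (x + s *\<^sub>R axis i 1)"
    by eventually_elim (use assms(4) in auto)
  then show ?thesis
    using assms(1) unfolding has_pdiff_def by (simp add: DERIV_cong_ev)
qed

lemma pdiff_cong:
  assumes "open M" "x \<in> M" "\<And>y. y \<in> M \<Longrightarrow> u y = v y"
  shows "pdiff i u x = pdiff i v x"
proof -
  \<comment> \<open>Both functions have the same candidate derivatives, so \<open>deriv\<close>
    makes the same choice, even if there are none.\<close>
  have "has_pdiff i u d x \<longleftrightarrow> has_pdiff i v d x" for d
    using assms by (metis has_pdiff_transform)
  then show ?thesis
    by (simp add: has_pdiff_def pdiff_def deriv_def)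
qed

lemma has_pdiff_fibre:
  fixes u :: "real \<times> real \<Rightarrow> real"
  assumes "u differentiable (at (x $ 3, x $ 4))"
  shows "has_pdiff i (\<lambda>y. u (y $ 3, y $ 4))
    (frechet_derivative u (at (x $ 3, x $ 4)) (axis i 1 $ 3, axis i 1 $ 4)) x"
  using has_real_derivative_along_line[of u "(x $ 3, x $ 4)" 0 "(axis i 1 $ 3, axis i 1 $ 4)"] assms
  by (simp add: has_pdiff_def zero_prod_def[symmetric])

text \<open>\<open>f\<close> is smooth on the projection of \<open>M\<close> to the last two
  coordinates; symmetry of its second derivatives is available once this projection is open.\<close>

lemma open_fibre_image:
  fixes M :: "point set"
  assumes "open M"
  shows "open ((\<lambda>x. (x $ 3, x $ 4)) ` M)"
proof (rule open_surjective_linear_image[OF assms])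
  show "linear (\<lambda>x::point. (x $ 3, x $ 4))"
    by (rule linearI) auto
  show "surj (\<lambda>x::point. (x $ 3, x $ 4))"
  proof (rule surjI)
    show "(\<lambda>x::point. (x $ 3, x $ 4)) (vector [0, 0, fst z, snd z]) = z" for z :: "real \<times> real"
      by simp
  qed
qed

lemma axis_1_nth [simp]:
  "axis (1::4) (1::real) $ 1 = 1" "axis (1::4) (1::real) $ 2 = 0" "axis (1::4) (1::real) $ 3 = 0" "axis (1::4) (1::real) $ 4 = 0"
  "axis (2::4) (1::real) $ 1 = 0" "axis (2::4) (1::real) $ 2 = 1" "axis (2::4) (1::real) $ 3 = 0" "axis (2::4) (1::real) $ 4 = 0"
  "axis (3::4) (1::real) $ 1 = 0" "axis (3::4) (1::real) $ 2 = 0" "axis (3::4) (1::real) $ 3 = 1" "axis (3::4) (1::real) $ 4 = 0"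
  "axis (4::4) (1::real) $ 1 = 0" "axis (4::4) (1::real) $ 2 = 0" "axis (4::4) (1::real) $ 3 = 0" "axis (4::4) (1::real) $ 4 = 1"
  by (simp_all add: axis_def)

section \<open>The curvature of the Robinson-Trautman metric\<close>

lemma sum_axis_mult: "(\<Sum>i\<in>UNIV. axis j (1::real) $ i * u i) = u j"
  by (simp add: axis_def if_distrib[of "\<lambda>z. z * _"] cong: if_cong)

lemma nabla_coord_field: "nabla g (coord_field i) (coord_field k) x = (\<chi> m. christoffel g x m i k)"
proof -
  have "(\<Sum>j\<in>UNIV. christoffel g x m i j * axis k 1 $ j) = christoffel g x m i k" for m
    using sum_axis_mult[of k "christoffel g x m i"] by (simp add: mult.commute)
  then show ?thesis
    by (simp add: nabla_def coord_field_def sum_axis_mult)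
qed

text \<open>Coordinate fields commute, so the bracket term vanishes. The derivative in direction
  \<open>j\<close> comes with the positive sign because of the sign convention in
  \<open>curvature_op\<close>.\<close>

lemma riemann_nth:
  "riemann g x $ i $ j $ k $ l = (\<Sum>m\<in>UNIV.
     (pdiff j (\<lambda>y. christoffel g y m i k) x - pdiff i (\<lambda>y. christoffel g y m j k) x
      + (\<Sum>n\<in>UNIV. christoffel g x m j n * christoffel g x n i k
                 - christoffel g x m i n * christoffel g x n j k)) * g x $ m $ l)"
proof -
  have "nabla g (coord_field j) (nabla g (coord_field i) (coord_field k)) x $ m
    = pdiff j (\<lambda>y. christoffel g y m i k) x + (\<Sum>n\<in>UNIV. christoffel g x m j n * christoffel g x n i k)"
    for i j m
    unfolding nabla_def[of g "coord_field j"] nabla_coord_field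
    by (simp add: coord_field_def sum_axis_mult)
  moreover have "nabla g (lie_bracket (coord_field i) (coord_field j)) (coord_field k) x = 0"
    by (simp add: nabla_def lie_bracket_def coord_field_def vec_eq_iff)
  ultimately have "curvature_op g (coord_field i) (coord_field j) (coord_field k) x $ m
    = pdiff j (\<lambda>y. christoffel g y m i k) x - pdiff i (\<lambda>y. christoffel g y m j k) x
      + (\<Sum>n\<in>UNIV. christoffel g x m j n * christoffel g x n i k
                 - christoffel g x m i n * christoffel g x n j k)" for m
    by (simp add: curvature_op_def sum_subtractf)
  moreover have "(g x *v coord_field l x) $ m = g x $ m $ l" for m
    using sum_axis_mult[of l "\<lambda>j. g x $ m $ j"]
    by (simp add: matrix_vector_mult_def coord_field_def mult.commute)
  ultimately show ?thesis
    by (simp add: riemann_def inner_vec_def)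
qed

lemma matrix_inv_unique:
  fixes A B :: "real^'n^'n"
  assumes "A ** B = mat 1"
  shows "matrix_inv A = B"
proof -
  have "B ** A = mat 1"
    using assms matrix_left_right_inverse by blast
  then have "A ** matrix_inv A = mat 1 \<and> matrix_inv A ** A = mat 1"
    using assms unfolding matrix_inv_def by (metis (mono_tags, lifting) someI)
  then have "matrix_inv A = matrix_inv A ** (A ** B)"
    using assms by simp
  also have "\<dots> = B"
    using \<open>A ** matrix_inv A = mat 1 \<and> matrix_inv A ** A = mat 1\<close> by (simp add: matrix_mul_assoc)
  finally show ?thesis .
qed

section \<open>The function \<open>f\<close> and its partial derivatives\<close>

locale robinson_trautman =
  fixes a b q :: real and f :: "real \<times> real \<Rightarrow> real" and M :: "point set"
  assumes open_M: "open M"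
    and r_nonzero: "x \<in> M \<Longrightarrow> x $ 2 \<noteq> 0"
    and smooth_f: "smooth_on ((\<lambda>x. (x $ 3, x $ 4)) ` M) f"
    and f_nonzero: "x \<in> M \<Longrightarrow> f (x $ 3, x $ 4) \<noteq> 0"
begin

abbreviation "g \<equiv> rt_metric a b q f"
abbreviation "F \<equiv> rt_F f"

definition f0 :: scalar_field where "f0 x = f (x $ 3, x $ 4)"
definition f3 :: scalar_field where "f3 x = frechet_derivative f (at (x $ 3, x $ 4)) (1, 0)"
definition f4 :: scalar_field where "f4 x = frechet_derivative f (at (x $ 3, x $ 4)) (0, 1)"
definition f33 :: scalar_field where
  "f33 x = frechet_derivative (\<lambda>z. frechet_derivative f (at z) (1, 0)) (at (x $ 3, x $ 4)) (1, 0)"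
definition f34 :: scalar_field where
  "f34 x = frechet_derivative (\<lambda>z. frechet_derivative f (at z) (1, 0)) (at (x $ 3, x $ 4)) (0, 1)"
definition f44 :: scalar_field where
  "f44 x = frechet_derivative (\<lambda>z. frechet_derivative f (at z) (0, 1)) (at (x $ 3, x $ 4)) (0, 1)"

lemma f0_nonzero: "x \<in> M \<Longrightarrow> f0 x \<noteq> 0"
  by (simp add: f0_def f_nonzero)

text \<open>The factors \<open>axis i 1 $ 3\<close> and \<open>axis i 1 $ 4\<close> treat all four
  directions in one formula; it gives 0 for \<open>t\<close> and \<open>r\<close>.\<close>

lemma has_pdiff_smooth_fibre:
  assumes "smooth_on ((\<lambda>x. (x $ 3, x $ 4)) ` M) u" "x \<in> M"
  shows "has_pdiff i (\<lambda>y. u (y $ 3, y $ 4))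
    (axis i 1 $ 3 * frechet_derivative u (at (x $ 3, x $ 4)) (1, 0)
     + axis i 1 $ 4 * frechet_derivative u (at (x $ 3, x $ 4)) (0, 1)) x"
proof -
  have d: "u differentiable (at (x $ 3, x $ 4))"
    using assms smooth_on_differentiable by blast
  let ?D = "frechet_derivative u (at (x $ 3, x $ 4))"
  have lin: "linear ?D"
    using d by (rule linear_frechet_derivative)
  have eq: "?D (s, t) = s * ?D (1, 0) + t * ?D (0, 1)" for s t :: real
  proof -
    have "(s, t) = s *\<^sub>R (1, 0) + t *\<^sub>R (0, 1)"
      by simp
    then have "?D (s, t) = ?D (s *\<^sub>R (1, 0) + t *\<^sub>R (0, 1))"
      by (rule arg_cong)
    also have "\<dots> = ?D (s *\<^sub>R (1, 0)) + ?D (t *\<^sub>R (0, 1))"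
      by (rule linear_add[OF lin])
    also have "\<dots> = s * ?D (1, 0) + t * ?D (0, 1)"
      by (simp only: linear_scale[OF lin] real_scaleR_def)
    finally show ?thesis .
  qed
  show ?thesis
    by (rule has_pdiff_eqI[OF has_pdiff_fibre[OF d]]) (rule eq)
qed

lemma has_pdiff_f0: "x \<in> M \<Longrightarrow> has_pdiff i f0 (axis i 1 $ 3 * f3 x + axis i 1 $ 4 * f4 x) x"
  unfolding f0_def[abs_def] f3_def f4_def by (rule has_pdiff_smooth_fibre[OF smooth_f])

lemma has_pdiff_f3: "x \<in> M \<Longrightarrow> has_pdiff i f3 (axis i 1 $ 3 * f33 x + axis i 1 $ 4 * f34 x) x"
  unfolding f3_def[abs_def] f33_def f34_def
  by (rule has_pdiff_smooth_fibre[OF smooth_on_frechet_derivative[OF smooth_f]])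

text \<open>Direction 3 produces the mixed derivative in the other order, which symmetry of second
  derivatives identifies with \<open>f34\<close>.\<close>

lemma has_pdiff_f4: "x \<in> M \<Longrightarrow> has_pdiff i f4 (axis i 1 $ 3 * f34 x + axis i 1 $ 4 * f44 x) x"
  using has_pdiff_smooth_fibre[OF smooth_on_frechet_derivative[OF smooth_f, of "(0, 1)"], of x i]
    smooth_on_mixed_derivatives[OF smooth_f open_fibre_image[OF open_M], of "(x $ 3, x $ 4)" "(1, 0)" "(0, 1)"]
  by (simp add: f4_def[abs_def] f34_def f44_def)

lemma F_eq:
  assumes "x \<in> M"
  shows "F x = (f3 x)\<^sup>2 + (f4 x)\<^sup>2 - f0 x * (f33 x + f44 x)"
proof -
  have 1: "pdiff 3 f0 y = f3 y" "pdiff 4 f0 y = f4 y" if "y \<in> M" for y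
    using that pdiff_eqI[OF has_pdiff_f0] by simp_all
  have "pdiff 3 (pdiff 3 f0) x = f33 x"
    using pdiff_cong[OF open_M assms 1(1)] pdiff_eqI[OF has_pdiff_f3[OF assms]] by simp
  moreover have "pdiff 4 (pdiff 4 f0) x = f44 x"
    using pdiff_cong[OF open_M assms 1(2)] pdiff_eqI[OF has_pdiff_f4[OF assms]] by simp
  ultimately show ?thesis
    using 1 assms by (simp add: rt_F_def Let_def f0_def[abs_def, symmetric])
qed

lemma has_pdiff_F:
  assumes "x \<in> M"
  obtains d :: "real^4" where "\<And>i. has_pdiff i F (axis i 1 $ 3 * d $ 3 + axis i 1 $ 4 * d $ 4) x"
proof -
  obtain d3 d4 where 3: "\<And>i. has_pdiff i f33 (axis i 1 $ 3 * d3 + axis i 1 $ 4 * d4) x"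
    using has_pdiff_smooth_fibre[OF smooth_on_frechet_derivative[OF smooth_on_frechet_derivative[OF smooth_f]] assms]
    unfolding f33_def[abs_def] by blast
  obtain e3 e4 where 4: "\<And>i. has_pdiff i f44 (axis i 1 $ 3 * e3 + axis i 1 $ 4 * e4) x"
    using has_pdiff_smooth_fibre[OF smooth_on_frechet_derivative[OF smooth_on_frechet_derivative[OF smooth_f]] assms]
    unfolding f44_def[abs_def] by blast
  \<comment> \<open>Components 3 and 4 are the product rule applied to \<open>F_eq\<close>, with
    third derivatives \<open>d3\<close>, \<open>d4\<close>, \<open>e3\<close>, \<open>e4\<close> of
    \<open>f\<close>; \<open>F\<close> does not depend on \<open>t\<close> and
    \<open>r\<close>.\<close>
  define d :: "real^4" where "d = vector [0, 0,
    2 * f3 x * f33 x + 2 * f4 x * f34 x - f3 x * (f33 x + f44 x) - f0 x * (d3 + e3),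
    2 * f3 x * f34 x + 2 * f4 x * f44 x - f4 x * (f33 x + f44 x) - f0 x * (d4 + e4)]"
  have "has_pdiff i F (axis i 1 $ 3 * d $ 3 + axis i 1 $ 4 * d $ 4) x" for i
  proof (rule has_pdiff_transform[OF _ open_M assms F_eq[symmetric]])
    show "has_pdiff i (\<lambda>x. (f3 x)\<^sup>2 + (f4 x)\<^sup>2 - f0 x * (f33 x + f44 x))
       (axis i 1 $ 3 * d $ 3 + axis i 1 $ 4 * d $ 4) x"
      by (auto intro!: assms has_pdiff_eq_intros has_pdiff_f0[THEN has_pdiff_eqI] has_pdiff_f3[THEN has_pdiff_eqI] has_pdiff_f4[THEN has_pdiff_eqI] 3[THEN has_pdiff_eqI] 4[THEN has_pdiff_eqI] simp: d_def algebra_simps)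
  qed
  then show ?thesis using that by blast
qed

section \<open>Base, fibre and Christoffel symbols of the metric\<close>

definition g11 :: scalar_field where "g11 x = - 2 * (a - 2 * b * x $ 2 - q / x $ 2)"
definition g33 :: scalar_field where "g33 x = - ((x $ 2)\<^sup>2 / (f0 x)\<^sup>2)"

definition base :: metric where
  "base x = vector [vector [g11 x, 1, 0, 0], vector [1, 0, 0, 0], vector [0, 0, 0, 0], vector [0, 0, 0, 0]]"

definition fibre :: metric where
  "fibre x = vector [vector [0, 0, 0, 0], vector [0, 0, 0, 0], vector [0, 0, g33 x, 0], vector [0, 0, 0, g33 x]]"

definition ginv :: "point \<Rightarrow> tensor2" where
  "ginv x = vector [vector [0, 1, 0, 0], vector [1, - g11 x, 0, 0],
     vector [0, 0, - ((f0 x)\<^sup>2 / (x $ 2)\<^sup>2), 0], vector [0, 0, 0, - ((f0 x)\<^sup>2 / (x $ 2)\<^sup>2)]]"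

lemma g_eq_vector: "g x = vector [vector [g11 x, 1, 0, 0], vector [1, 0, 0, 0],
    vector [0, 0, g33 x, 0], vector [0, 0, 0, g33 x]]"
  by (simp add: rt_metric_def g11_def g33_def f0_def)

lemma g_eq: "g x = base x + fibre x"
  by (simp add: g_eq_vector base_def fibre_def vec_eq_iff forall_4)

lemma matrix_inv_g: "x \<in> M \<Longrightarrow> matrix_inv (g x) = ginv x"
  by (rule matrix_inv_unique)
    (simp add: g_eq_vector ginv_def g33_def vec_eq_iff forall_4 sum_4 matrix_matrix_mult_def mat_def
      r_nonzero f0_nonzero)

lemma metric_splitting: "x \<in> M \<Longrightarrow> metric_splitting (base x) (fibre x) (g x)"
proof -
  assume x: "x \<in> M"
  have "\<forall>i j. base x $ i $ j = base x $ j $ i" "\<forall>i j. fibre x $ i $ j = fibre x $ j $ i"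
    "\<forall>i j. ginv x $ i $ j = ginv x $ j $ i"
    by (simp_all add: forall_4 base_def fibre_def ginv_def)
  moreover have "base x ** ginv x ** base x = base x" "base x ** ginv x ** fibre x = 0"
    "fibre x ** ginv x ** base x = 0" "fibre x ** ginv x ** fibre x = fibre x"
    using x r_nonzero f0_nonzero
    by (simp_all add: vec_eq_iff forall_4 matrix_matrix_mult_def sum_4 base_def fibre_def ginv_def g33_def)
  ultimately show ?thesis
    by unfold_locales (simp_all add: g_eq[symmetric] matrix_inv_g x)
qed

definition half_dg11 :: scalar_field where "half_dg11 x = 2 * b - q / (x $ 2)\<^sup>2"

text \<open>The outermost index is the upper one. Besides the symbols of base and fibre, the entries
  with \<open>x $ 2 / (f0 x)\<^sup>2\<close> or \<open>1 / x $ 2\<close> come from the warping by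
  \<open>r\<close>.\<close>

definition Gamma :: "point \<Rightarrow> real^4^4^4" where
  "Gamma x = vector [
     vector [vector [- half_dg11 x, 0, 0, 0], vector [0, 0, 0, 0],
       vector [0, 0, x $ 2 / (f0 x)\<^sup>2, 0], vector [0, 0, 0, x $ 2 / (f0 x)\<^sup>2]],
     vector [vector [g11 x * half_dg11 x, half_dg11 x, 0, 0], vector [half_dg11 x, 0, 0, 0],
       vector [0, 0, - (x $ 2 * g11 x / (f0 x)\<^sup>2), 0], vector [0, 0, 0, - (x $ 2 * g11 x / (f0 x)\<^sup>2)]],
     vector [vector [0, 0, 0, 0], vector [0, 0, 1 / x $ 2, 0],
       vector [0, 1 / x $ 2, - (f3 x / f0 x), - (f4 x / f0 x)], vector [0, 0, - (f4 x / f0 x), f3 x / f0 x]],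
     vector [vector [0, 0, 0, 0], vector [0, 0, 0, 1 / x $ 2],
       vector [0, 0, f4 x / f0 x, - (f3 x / f0 x)], vector [0, 1 / x $ 2, - (f3 x / f0 x), - (f4 x / f0 x)]]]"

lemma has_pdiff_g11: "x \<in> M \<Longrightarrow> has_pdiff i g11 (axis i 1 $ 2 * (2 * half_dg11 x)) x"
  unfolding g11_def[abs_def]
  by (auto intro!: has_pdiff_eq_intros simp: r_nonzero half_dg11_def field_simps power2_eq_square)

lemma has_pdiff_half_dg11: "x \<in> M \<Longrightarrow> has_pdiff i half_dg11 (axis i 1 $ 2 * (2 * q / (x $ 2)^3)) x"
  unfolding half_dg11_def[abs_def]
  by (auto intro!: has_pdiff_eq_intros simp: r_nonzero field_simps power2_eq_square power3_eq_cube)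

lemma has_pdiff_g33: "x \<in> M \<Longrightarrow> has_pdiff i g33 (- (axis i 1 $ 2 * (2 * x $ 2 / (f0 x)\<^sup>2))
    + (axis i 1 $ 3 * f3 x + axis i 1 $ 4 * f4 x) * (2 * (x $ 2)\<^sup>2 / (f0 x)^3)) x"
  unfolding g33_def[abs_def]
  by (auto intro!: has_pdiff_eq_intros has_pdiff_f0[THEN has_pdiff_eqI] simp: r_nonzero f0_nonzero field_simps power2_eq_square power3_eq_cube)

lemma has_pdiff_inverse_r: "x \<in> M \<Longrightarrow> has_pdiff i (\<lambda>y. 1 / y $ 2) (- (axis i 1 $ 2 / (x $ 2)\<^sup>2)) x"
  by (auto intro!: has_pdiff_eq_intros simp: r_nonzero field_simps power2_eq_square)

lemma has_pdiff_r_f: "x \<in> M \<Longrightarrow> has_pdiff i (\<lambda>y. y $ 2 / (f0 y)\<^sup>2) (axis i 1 $ 2 / (f0 x)\<^sup>2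
    - (axis i 1 $ 3 * f3 x + axis i 1 $ 4 * f4 x) * (2 * x $ 2 / (f0 x)^3)) x"
  by (auto intro!: has_pdiff_eq_intros has_pdiff_f0[THEN has_pdiff_eqI] simp: f0_nonzero field_simps power2_eq_square power3_eq_cube)

lemma has_pdiff_r_g11_f: "x \<in> M \<Longrightarrow> has_pdiff i (\<lambda>y. y $ 2 * g11 y / (f0 y)\<^sup>2)
    (axis i 1 $ 2 * ((g11 x + 2 * x $ 2 * half_dg11 x) / (f0 x)\<^sup>2)
    - (axis i 1 $ 3 * f3 x + axis i 1 $ 4 * f4 x) * (2 * x $ 2 * g11 x / (f0 x)^3)) x"
  by (auto intro!: has_pdiff_eq_intros has_pdiff_f0[THEN has_pdiff_eqI] has_pdiff_g11[THEN has_pdiff_eqI]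
      simp: f0_nonzero field_simps power2_eq_square power3_eq_cube)

lemma has_pdiff_f3_f: "x \<in> M \<Longrightarrow> has_pdiff i (\<lambda>y. f3 y / f0 y)
    ((axis i 1 $ 3 * f33 x + axis i 1 $ 4 * f34 x) / f0 x
      - (axis i 1 $ 3 * f3 x + axis i 1 $ 4 * f4 x) * f3 x / (f0 x)\<^sup>2) x"
  by (auto intro!: has_pdiff_eq_intros has_pdiff_f0[THEN has_pdiff_eqI] has_pdiff_f3[THEN has_pdiff_eqI] simp: f0_nonzero field_simps power2_eq_square)

lemma has_pdiff_f4_f: "x \<in> M \<Longrightarrow> has_pdiff i (\<lambda>y. f4 y / f0 y)
    ((axis i 1 $ 3 * f34 x + axis i 1 $ 4 * f44 x) / f0 x
      - (axis i 1 $ 3 * f3 x + axis i 1 $ 4 * f4 x) * f4 x / (f0 x)\<^sup>2) x"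
  by (auto intro!: has_pdiff_eq_intros has_pdiff_f0[THEN has_pdiff_eqI] has_pdiff_f4[THEN has_pdiff_eqI] simp: f0_nonzero field_simps power2_eq_square)

text \<open>Derivatives of the nonconstant entries of \<open>Gamma\<close>, with the signs with
  which they occur there.\<close>

lemmas pdiff_Gamma_entries =
  has_pdiff_half_dg11[THEN pdiff_eqI]
  has_pdiff_half_dg11[THEN has_pdiff_minus, THEN pdiff_eqI]
  has_pdiff_mult[OF has_pdiff_g11 has_pdiff_half_dg11, THEN pdiff_eqI]
  has_pdiff_r_f[THEN pdiff_eqI]
  has_pdiff_r_g11_f[THEN has_pdiff_minus, THEN pdiff_eqI]
  has_pdiff_inverse_r[THEN pdiff_eqI]
  has_pdiff_f3_f[THEN pdiff_eqI] has_pdiff_f3_f[THEN has_pdiff_minus, THEN pdiff_eqI]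
  has_pdiff_f4_f[THEN pdiff_eqI] has_pdiff_f4_f[THEN has_pdiff_minus, THEN pdiff_eqI]

lemma christoffel_g:
  assumes x: "x \<in> M"
  shows "christoffel g x m i j = Gamma x $ m $ i $ j"
proof -
  have r: "x $ 2 \<noteq> 0" and f: "f0 x \<noteq> 0" using x r_nonzero f0_nonzero by auto
  have "\<forall>m i j. christoffel g x m i j = Gamma x $ m $ i $ j"
    unfolding forall_4 christoffel_def matrix_inv_g[OF x]
    by (simp add: sum_4 g_eq_vector ginv_def Gamma_def
        pdiff_eqI[OF has_pdiff_g11[OF x]] pdiff_eqI[OF has_pdiff_g33[OF x]])
      (simp add: r f field_simps power2_eq_square power3_eq_cube)
  then show ?thesis by blast
qed

text \<open>
  \<open>cA\<close>, \<open>cB\<close>, \<open>cD\<close> are the coefficients of \<open>h \<owedge> h\<close>, \<open>h \<owedge> k\<close>, \<open>k \<owedge> k\<close> in the Riemann tensor,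
  \<open>cS\<close> and \<open>cU\<close> those of \<open>h\<close> and \<open>k\<close> in the Ricci tensor, and \<open>cC\<close> is the coefficient of
  \<open>h \<owedge> k\<close> in the conformal tensor.
\<close>

definition cA :: scalar_field where "cA x = - q / (x $ 2)^3"
definition cB :: scalar_field where "cB x = (q - 2 * b * (x $ 2)\<^sup>2) / (x $ 2)^3"
definition cS :: scalar_field where "cS x = - 4 * b / x $ 2"
definition cU :: scalar_field where "cU x = (2 * a - 8 * b * x $ 2 - F x) / (x $ 2)\<^sup>2"
definition cD :: scalar_field where "cD x = cU x / 2 - cB x"

end

section \<open>The curvature tensors as block tensors\<close>

lemma riemann_skew: "riemann G x $ i $ j $ k $ l = - riemann G x $ j $ i $ k $ l"
  unfolding riemann_nth by (simp add: sum_4 algebra_simps)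

lemma block_tensor_skew:
  "block_tensor h k \<alpha> \<beta> \<gamma> $ i $ j $ m $ l = - block_tensor h k \<alpha> \<beta> \<gamma> $ j $ i $ m $ l"
  by (simp add: block_tensor_def kulkarni_nomizu_def algebra_simps)

lemma block_tensor_cong:
  "\<alpha> = \<alpha>' \<Longrightarrow> \<beta> = \<beta>' \<Longrightarrow> \<gamma> = \<gamma>' \<Longrightarrow> block_tensor h k \<alpha> \<beta> \<gamma> = block_tensor h k \<alpha>' \<beta>' \<gamma>'"
  by simp

context robinson_trautman
begin

lemma pdiff_christoffel_g:
  "x \<in> M \<Longrightarrow> pdiff j (\<lambda>y. christoffel g y m i k) x = pdiff j (\<lambda>y. Gamma y $ m $ i $ k) x"
  by (rule pdiff_cong[OF open_M]) (auto intro: christoffel_g)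

text \<open>Direct computation from the Christoffel symbols. \<open>F\<close> enters only for the
  index pair 3, 4: it is minus the Gauss curvature of the flat metric of the fibre coordinates
  divided by \<open>f^2\<close>.\<close>

lemma riemann_g:
  assumes x: "x \<in> M"
  shows "riemann g x = block_tensor (base x) (fibre x) (cA x) (cB x) (cD x)"
proof -
  have r: "x $ 2 \<noteq> 0" and f: "f0 x \<noteq> 0"
    using x r_nonzero f0_nonzero by auto
  note simps = sum_4 Gamma_def g_eq_vector base_def fibre_def block_tensor_def kulkarni_nomizu_def
    pdiff_Gamma_entries x
  note coeff_defs = cA_def cB_def cD_def cU_def g33_def F_eq half_dg11_def
  let ?B = "block_tensor (base x) (fibre x) (cA x) (cB x) (cD x)"
  have R12: "\<forall>k l. riemann g x $ 1 $ 2 $ k $ l = ?B $ 1 $ 2 $ k $ l"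
    unfolding riemann_nth pdiff_christoffel_g[OF x] christoffel_g[OF x] forall_4
    by (simp add: simps, intro conjI; simp add: r f x coeff_defs field_simps;
        simp add: r f x g11_def field_simps eval_nat_numeral)
  have R13: "\<forall>k l. riemann g x $ 1 $ 3 $ k $ l = ?B $ 1 $ 3 $ k $ l"
    unfolding riemann_nth pdiff_christoffel_g[OF x] christoffel_g[OF x] forall_4
    by (simp add: simps, intro conjI; simp add: r f x coeff_defs field_simps;
        simp add: r f x g11_def field_simps eval_nat_numeral)
  have R14: "\<forall>k l. riemann g x $ 1 $ 4 $ k $ l = ?B $ 1 $ 4 $ k $ l"
    unfolding riemann_nth pdiff_christoffel_g[OF x] christoffel_g[OF x] forall_4
    by (simp add: simps, intro conjI; simp add: r f x coeff_defs field_simps;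
        simp add: r f x g11_def field_simps eval_nat_numeral)
  have R23: "\<forall>k l. riemann g x $ 2 $ 3 $ k $ l = ?B $ 2 $ 3 $ k $ l"
    unfolding riemann_nth pdiff_christoffel_g[OF x] christoffel_g[OF x] forall_4
    by (simp add: simps, intro conjI; simp add: r f x coeff_defs field_simps;
        simp add: r f x g11_def field_simps eval_nat_numeral)
  have R24: "\<forall>k l. riemann g x $ 2 $ 4 $ k $ l = ?B $ 2 $ 4 $ k $ l"
    unfolding riemann_nth pdiff_christoffel_g[OF x] christoffel_g[OF x] forall_4
    by (simp add: simps, intro conjI; simp add: r f x coeff_defs field_simps;
        simp add: r f x g11_def field_simps eval_nat_numeral)
  have R34: "\<forall>k l. riemann g x $ 3 $ 4 $ k $ l = ?B $ 3 $ 4 $ k $ l"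
    unfolding riemann_nth pdiff_christoffel_g[OF x] christoffel_g[OF x] forall_4
    by (simp add: simps, intro conjI; simp add: r f x coeff_defs field_simps;
        simp add: r f x g11_def field_simps eval_nat_numeral)
  \<comment> \<open>Skewness of both sides in the first two indices extends the six computed pairs
    to all pairs.\<close>
  define P where "P i j \<longleftrightarrow> (\<forall>k l. riemann g x $ i $ j $ k $ l = ?B $ i $ j $ k $ l)" for i j
  have "P i i" for i
    unfolding P_def
    using riemann_skew[of g x i i] block_tensor_skew[of "base x" "fibre x" "cA x" "cB x" "cD x" i i]
    by (metis equal_neg_zero)
  moreover have "P j i" if "P i j" for i j
    using that riemann_skew[of g x i j]
      block_tensor_skew[of "base x" "fibre x" "cA x" "cB x" "cD x" i j] by (simp add: P_def)
  moreover have "P 1 2" "P 1 3" "P 1 4" "P 2 3" "P 2 4" "P 3 4"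
    unfolding P_def by (rule R12 R13 R14 R23 R24 R34)+
  ultimately have "\<forall>i j. P i j"
    unfolding forall_4 by blast
  then show ?thesis by (simp add: P_def vec_eq_iff)
qed

text \<open>Tracing over two-dimensional blocks turns \<open>h \<owedge> h\<close> into
  \<open>2 h\<close>, \<open>h \<owedge> k\<close> into \<open>2 h + 2 k\<close> and
  \<open>k \<owedge> k\<close> into \<open>2 k\<close>; \<open>cD\<close> is chosen to make the
  fibre coefficient \<open>cU\<close>.\<close>

lemma ricci_g:
  assumes x: "x \<in> M"
  shows "ricci g x = cS x *\<^sub>R base x + cU x *\<^sub>R fibre x"
proof -
  have r: "x $ 2 \<noteq> 0" and f: "f0 x \<noteq> 0"
    using x r_nonzero f0_nonzero by auto
  have S: "cS x = 2 * cA x + 2 * cB x"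
    using r by (simp add: cS_def cA_def cB_def field_simps eval_nat_numeral)
  have U: "cU x = 2 * cB x + 2 * cD x"
    by (simp add: cD_def)
  show ?thesis
    unfolding ricci_def matrix_inv_g[OF x] riemann_g[OF x] S U vec_eq_iff forall_4
    using r f
    by (simp add: sum_4 ginv_def block_tensor_def kulkarni_nomizu_def base_def fibre_def g33_def field_simps)
qed

lemma metric_trace_g:
  "x \<in> M \<Longrightarrow> metric_trace (g x) E
    = E $ 1 $ 2 + E $ 2 $ 1 - g11 x * E $ 2 $ 2
      - (f0 x)\<^sup>2 / (x $ 2)\<^sup>2 * (E $ 3 $ 3 + E $ 4 $ 4)"
  by (simp add: metric_trace_def matrix_inv_g ginv_def sum_4 algebra_simps)

lemma scalar_curvature_g:
  assumes x: "x \<in> M"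
  shows "scalar_curvature g x = 2 * cS x + 2 * cU x"
  using r_nonzero[OF x] f0_nonzero[OF x]
  by (simp add: scalar_curvature_def ricci_g metric_trace_g x base_def fibre_def g33_def)

definition cC :: scalar_field where "cC x = - ((2 * a * x $ 2 - 6 * q - F x * x $ 2) / (6 * (x $ 2)^3))"

lemma g_block: "g x = 1 *\<^sub>R base x + 1 *\<^sub>R fibre x"
  by (simp add: g_eq)

text \<open>The sign pattern is that of a trace-free block tensor: both traces,
  \<open>2 \<alpha> + 2 \<beta>\<close> and \<open>2 \<beta> + 2 \<gamma>\<close>, vanish.\<close>

lemma conformal_g:
  assumes x: "x \<in> M"
  shows "conformal g x = block_tensor (base x) (fibre x) (- cC x) (cC x) (- cC x)"
proof -
  have r: "x $ 2 \<noteq> 0"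
    using x r_nonzero by auto
  show ?thesis
    unfolding conformal_def riemann_g[OF x] ricci_g[OF x] scalar_curvature_g[OF x] g_block
      kulkarni_nomizu_block block_tensor_scaleR block_tensor_add block_tensor_diff
    by (rule block_tensor_cong; use r in \<open>simp add: cA_def cB_def cS_def cU_def cD_def cC_def
        field_simps eval_nat_numeral\<close>)
qed

text \<open>Pseudosymmetry and compatibility depend on the block shape alone, so the coefficients
  stay anonymous.\<close>

lemma concircular_g:
  assumes x: "x \<in> M"
  obtains \<alpha> \<beta> \<gamma> where "concircular g x = block_tensor (base x) (fibre x) \<alpha> \<beta> \<gamma>"
  unfolding concircular_def riemann_g[OF x] ricci_g[OF x] g_block
    kulkarni_nomizu_block block_tensor_scaleR block_tensor_add block_tensor_diff by blast

lemma conharmonic_g: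
  assumes x: "x \<in> M"
  obtains \<alpha> \<beta> \<gamma> where "conharmonic g x = block_tensor (base x) (fibre x) \<alpha> \<beta> \<gamma>"
  unfolding conharmonic_def riemann_g[OF x] ricci_g[OF x] g_block
    kulkarni_nomizu_block block_tensor_scaleR block_tensor_add block_tensor_diff by blast

text \<open>The projective tensor contains only half of a Kulkarni-Nomizu product, so it is treated
  through \<open>outer_prod\<close> and \<open>swap12\<close> rather than as a block tensor.\<close>

lemma projective_outer_prod:
  "projective g x = riemann g x
    - (1/3) *\<^sub>R (outer_prod (g x) (ricci g x) - swap12 (outer_prod (g x) (ricci g x)))"
  by (simp add: projective_def outer_prod_def swap12_def vec_eq_iff)

lemma pseudosym4_projective:
  assumes x: "x \<in> M"
  shows "pseudosym4 (g x) (block_tensor (base x) (fibre x) \<alpha> \<beta> \<gamma>) \<beta> (projective g x)"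
proof -
  interpret metric_splitting "base x" "fibre x" "g x"
    by (rule metric_splitting[OF x])
  have "pseudosym4 (g x) (block_tensor (base x) (fibre x) \<alpha> \<beta> \<gamma>) \<beta> (outer_prod (g x) (ricci g x))"
    using pseudosym2_block[of \<alpha> \<beta> \<gamma> 1 1] pseudosym2_block[of \<alpha> \<beta> \<gamma> "cS x" "cU x"]
    unfolding ricci_g[OF x] g_block[symmetric] by (rule pseudosym4_outer_prod)
  then show ?thesis
    unfolding projective_outer_prod riemann_g[OF x]
    by (intro pseudosym4_diff pseudosym4_scaleR pseudosym4_swap12 pseudosym4_block)
qed

end

section \<open>Recurrence of the conformal curvature 2-forms\<close>

text \<open>\<open>dh\<close> and \<open>dk\<close> say that the covariant derivatives of
  \<open>h\<close> and \<open>k\<close> in direction \<open>e\<close> are \<open>Y\<close> and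
  \<open>- Y\<close>. For \<open>- h \<owedge> h + h \<owedge> k - k \<owedge> k\<close> the Leibniz
  rule then gives \<open>- 2 Y \<owedge> h + Y \<owedge> k - Y \<owedge> h + 2 Y \<owedge>
  k\<close>, which is \<open>3 Y \<owedge> (k - h)\<close>.\<close>

lemma nabla4_block:
  fixes h k :: metric
  assumes sym: "\<And>y i j. h y $ i $ j = h y $ j $ i" "\<And>y i j. k y $ i $ j = k y $ j $ i"
    and dc: "has_pdiff e c dc x"
    and dh: "\<And>i j. has_pdiff e (\<lambda>y. h y $ i $ j)
      ((\<Sum>m\<in>UNIV. christoffel G x m e i * h x $ m $ j) + (\<Sum>m\<in>UNIV. christoffel G x m e j * h x $ m $ i) + Y $ i $ j) x"
    and dk: "\<And>i j. has_pdiff e (\<lambda>y. k y $ i $ j)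
      ((\<Sum>m\<in>UNIV. christoffel G x m e i * k x $ m $ j) + (\<Sum>m\<in>UNIV. christoffel G x m e j * k x $ m $ i) - Y $ i $ j) x"
  shows "nabla4 G (\<lambda>y. block_tensor (h y) (k y) (- c y) (c y) (- c y)) x $ e
    = dc *\<^sub>R block_tensor (h x) (k x) (-1) 1 (-1) + (3 * c x) *\<^sub>R (Y \<owedge> (k x - h x))"
proof -
  define Gh where "Gh i j = (\<Sum>m\<in>UNIV. christoffel G x m e i * h x $ m $ j)" for i j
  define Gk where "Gk i j = (\<Sum>m\<in>UNIV. christoffel G x m e i * k x $ m $ j)" for i j
  define Z where "Z y = block_tensor (h y) (k y) (-1) 1 (-1)" for y
  have Z: "Z y $ i $ j $ l $ m = - 2 * (h y $ i $ m * h y $ j $ l - h y $ i $ l * h y $ j $ m)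
      + (h y $ i $ m * k y $ j $ l + h y $ j $ l * k y $ i $ m - h y $ i $ l * k y $ j $ m - h y $ j $ m * k y $ i $ l)
      - 2 * (k y $ i $ m * k y $ j $ l - k y $ i $ l * k y $ j $ m)" for y i j l m
    by (simp add: Z_def block_tensor_def kulkarni_nomizu_def algebra_simps)
  have cZ: "block_tensor (h y) (k y) (- c y) (c y) (- c y) = c y *\<^sub>R Z y" for y
    by (simp add: Z_def block_tensor_scaleR)
  have G1: "(\<Sum>n\<in>UNIV. christoffel G x n e i * (c x * Z x $ n $ j $ l $ m)) =
      c x * (- 2 * (Gh i m * h x $ j $ l - Gh i l * h x $ j $ m)
      + (Gh i m * k x $ j $ l + h x $ j $ l * Gk i m - Gh i l * k x $ j $ m - h x $ j $ m * Gk i l)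
      - 2 * (Gk i m * k x $ j $ l - Gk i l * k x $ j $ m))" for i j l m
    by (simp add: Z Gh_def Gk_def sum_4 algebra_simps)
  \<comment> \<open>The curvature symmetries of \<open>Z\<close> move every Christoffel contraction
    to the first slot, where \<open>G1\<close> evaluates it.\<close>
  have Zsym: "Z x $ i $ n $ l $ m = - Z x $ n $ i $ l $ m" "Z x $ i $ j $ n $ m = Z x $ n $ m $ i $ j"
    "Z x $ i $ j $ l $ n = - Z x $ n $ l $ i $ j" for i j l m n
    by (simp_all add: Z sym algebra_simps)
  have G2: "(\<Sum>n\<in>UNIV. christoffel G x n e j * (c x * Z x $ i $ n $ l $ m))
     = - (\<Sum>n\<in>UNIV. christoffel G x n e j * (c x * Z x $ n $ i $ l $ m))" for i j l m
    by (subst Zsym(1)) (simp add: sum_negf)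
  have G3: "(\<Sum>n\<in>UNIV. christoffel G x n e l * (c x * Z x $ i $ j $ n $ m))
     = (\<Sum>n\<in>UNIV. christoffel G x n e l * (c x * Z x $ n $ m $ i $ j))" for i j l m
    by (subst Zsym(2)) simp
  have G4: "(\<Sum>n\<in>UNIV. christoffel G x n e m * (c x * Z x $ i $ j $ l $ n))
     = - (\<Sum>n\<in>UNIV. christoffel G x n e m * (c x * Z x $ n $ l $ i $ j))" for i j l m
    by (subst Zsym(3)) (simp add: sum_negf)
  have D: "pdiff e (\<lambda>y. (c y *\<^sub>R Z y) $ i $ j $ l $ m) x = dc * Z x $ i $ j $ l $ m + c x * 
     (let H = \<lambda>i j. Gh i j + Gh j i + Y $ i $ j; K = \<lambda>i j. Gk i j + Gk j i - Y $ i $ j in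
       - 2 * (H i m * h x $ j $ l + h x $ i $ m * H j l - H i l * h x $ j $ m - h x $ i $ l * H j m)
      + (H i m * k x $ j $ l + H j l * k x $ i $ m - H i l * k x $ j $ m - H j m * k x $ i $ l)
      + (h x $ i $ m * K j l + h x $ j $ l * K i m - h x $ i $ l * K j m - h x $ j $ m * K i l)
      - 2 * (K i m * k x $ j $ l + k x $ i $ m * K j l - K i l * k x $ j $ m - k x $ i $ l * K j m))" for i j l m
    unfolding Let_def Z vector_scaleR_component real_scaleR_def
    by (rule pdiff_eqI, rule has_pdiff_eqI, (rule has_pdiff_mult has_pdiff_add has_pdiff_diff has_pdiff_const dc
        dh[folded Gh_def] dk[folded Gk_def])+) (simp add: algebra_simps)
  show ?thesis
    unfolding nabla4_def cZ vec_eq_iff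
    by (simp only: vec_lambda_beta D,
        simp only: vector_scaleR_component real_scaleR_def vector_add_component sum.distrib G1 G2 G3 G4)
      (simp add: Z_def[symmetric] kulkarni_nomizu_def Let_def sym algebra_simps)
qed

context robinson_trautman
begin

lemma base_sym: "base x $ i $ j = base x $ j $ i"
proof -
  have "\<forall>i j. base x $ i $ j = base x $ j $ i"
    by (simp add: forall_4 base_def)
  then show ?thesis by blast
qed

lemma fibre_sym: "fibre x $ i $ j = fibre x $ j $ i"
proof -
  have "\<forall>i j. fibre x $ i $ j = fibre x $ j $ i"
    by (simp add: forall_4 fibre_def)
  then show ?thesis by blast
qed

text \<open>The last summand is the covariant derivative of the base metric,
  \<open>axis j 1 $ 2\<close> being a component of \<open>dr\<close>. The fibre metric has the
  opposite one, since their sum is parallel.\<close>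

lemma has_pdiff_base:
  assumes x: "x \<in> M"
  shows "has_pdiff e (\<lambda>y. base y $ i $ j)
    ((\<Sum>m\<in>UNIV. christoffel g x m e i * base x $ m $ j) + (\<Sum>m\<in>UNIV. christoffel g x m e j * base x $ m $ i)
     + (fibre x $ e $ i * axis j 1 $ 2 + fibre x $ e $ j * axis i 1 $ 2) / x $ 2) x"
proof -
  have r: "x $ 2 \<noteq> 0" and f: "f0 x \<noteq> 0"
    using x r_nonzero f0_nonzero by auto
  have "has_pdiff e (\<lambda>y. base y $ i $ j) (if i = 1 \<and> j = 1 then axis e 1 $ 2 * (2 * half_dg11 x) else 0) x"
    using exhaust_4[of i] exhaust_4[of j] has_pdiff_g11[OF x, of e] has_pdiff_const[of e _ x]
    by (auto simp: base_def)
  moreover have eq: "\<forall>e i j. (if i = 1 \<and> j = 1 then axis e 1 $ 2 * (2 * half_dg11 x) else 0)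
    = (\<Sum>m\<in>UNIV. Gamma x $ m $ e $ i * base x $ m $ j) + (\<Sum>m\<in>UNIV. Gamma x $ m $ e $ j * base x $ m $ i)
     + (fibre x $ e $ i * axis j 1 $ 2 + fibre x $ e $ j * axis i 1 $ 2) / x $ 2"
    unfolding forall_4
    using r f by (simp add: sum_4 base_def fibre_def Gamma_def g33_def field_simps power2_eq_square)
  ultimately show ?thesis
    unfolding christoffel_g[OF x] by (blast intro: has_pdiff_eqI[OF _ eq[rule_format]])
qed

lemma has_pdiff_fibre_metric:
  assumes x: "x \<in> M"
  shows "has_pdiff e (\<lambda>y. fibre y $ i $ j)
    ((\<Sum>m\<in>UNIV. christoffel g x m e i * fibre x $ m $ j) + (\<Sum>m\<in>UNIV. christoffel g x m e j * fibre x $ m $ i)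
     - (fibre x $ e $ i * axis j 1 $ 2 + fibre x $ e $ j * axis i 1 $ 2) / x $ 2) x"
proof -
  have r: "x $ 2 \<noteq> 0" and f: "f0 x \<noteq> 0"
    using x r_nonzero f0_nonzero by auto
  define d where "d e = - (axis e 1 $ 2 * (2 * x $ 2 / (f0 x)\<^sup>2))
    + (axis e 1 $ 3 * f3 x + axis e 1 $ 4 * f4 x) * (2 * (x $ 2)\<^sup>2 / (f0 x)^3)" for e :: 4
  have "has_pdiff e (\<lambda>y. fibre y $ i $ j) (if i = j \<and> (i = 3 \<or> i = 4) then d e else 0) x"
    using exhaust_4[of i] exhaust_4[of j] has_pdiff_g33[OF x, of e] has_pdiff_const[of e _ x]
    by (auto simp: fibre_def d_def)
  moreover have eq: "\<forall>e i j. (if i = j \<and> (i = 3 \<or> i = 4) then d e else 0)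
    = (\<Sum>m\<in>UNIV. Gamma x $ m $ e $ i * fibre x $ m $ j) + (\<Sum>m\<in>UNIV. Gamma x $ m $ e $ j * fibre x $ m $ i)
     - (fibre x $ e $ i * axis j 1 $ 2 + fibre x $ e $ j * axis i 1 $ 2) / x $ 2"
    unfolding forall_4
    using r f by (simp add: sum_4 d_def fibre_def Gamma_def g33_def field_simps eval_nat_numeral)
  ultimately show ?thesis
    unfolding christoffel_g[OF x] by (blast intro: has_pdiff_eqI[OF _ eq[rule_format]])
qed

text \<open>Alternation over three indices kills the pure base and pure fibre terms because both blocks are
  two-dimensional, so this identity has no analogue for general \<open>h\<close> and \<open>k\<close>.\<close>

lemma cyclic_identity:
  fixes x \<rho> :: "real^4" and Y :: "4 \<Rightarrow> tensor2"
  defines "\<rho> \<equiv> axis 2 1"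
  defines "Y \<equiv> \<lambda>i. \<chi> j m. fibre x $ i $ j * \<rho> $ m + fibre x $ i $ m * \<rho> $ j"
  defines "Z \<equiv> block_tensor (base x) (fibre x) (-1) 1 (-1)"
  defines "T \<equiv> \<lambda>i. Y i \<owedge> (fibre x - base x)"
  shows "\<rho> $ i * Z $ j $ k $ l $ m + \<rho> $ j * Z $ k $ i $ l $ m + \<rho> $ k * Z $ i $ j $ l $ m
    = T i $ j $ k $ l $ m + T j $ k $ i $ l $ m + T k $ i $ j $ l $ m"
proof -
  \<comment> \<open>Both sides are alternating in \<open>i\<close>, \<open>j\<close>,
    \<open>k\<close>, so the four increasing triples suffice.\<close>
  define P where "P i j k \<longleftrightarrow> (\<forall>l m. \<rho> $ i * Z $ j $ k $ l $ m + \<rho> $ j * Z $ k $ i $ l $ m + \<rho> $ k * Z $ i $ j $ l $ m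
    = T i $ j $ k $ l $ m + T j $ k $ i $ l $ m + T k $ i $ j $ l $ m)" for i j k
  have Z: "Z $ i $ j $ l $ m = - Z $ j $ i $ l $ m" for i j l m
    unfolding Z_def by (rule block_tensor_skew)
  have T: "T e $ i $ j $ l $ m = - T e $ j $ i $ l $ m" for e i j l m
    by (simp add: T_def kulkarni_nomizu_def)
  have rot: "P j k i" if "P i j k" for i j k
    using that by (simp add: P_def algebra_simps)
  have swap: "P j i k" if "P i j k" for i j k
    unfolding P_def
  proof (intro allI)
    fix l m
    show "\<rho> $ j * Z $ i $ k $ l $ m + \<rho> $ i * Z $ k $ j $ l $ m + \<rho> $ k * Z $ j $ i $ l $ m
      = T j $ i $ k $ l $ m + T i $ k $ j $ l $ m + T k $ j $ i $ l $ m"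
      using that[unfolded P_def, rule_format, of l m] Z[of i k l m] Z[of k j l m] Z[of j i l m]
        T[of j i k l m] T[of i k j l m] T[of k j i l m] by simp
  qed
  have diag: "P i i k" for i k
    unfolding P_def
  proof (intro allI)
    fix l m
    show "\<rho> $ i * Z $ i $ k $ l $ m + \<rho> $ i * Z $ k $ i $ l $ m + \<rho> $ k * Z $ i $ i $ l $ m
      = T i $ i $ k $ l $ m + T i $ k $ i $ l $ m + T k $ i $ i $ l $ m"
      using Z[of i k l m] Z[of i i l m] T[of i i k l m] T[of k i i l m] by simp
  qed
  note simps = P_def forall_4 \<rho>_def Y_def Z_def T_def base_def fibre_def block_tensor_def kulkarni_nomizu_def
  have P123: "P 1 2 3" by (simp add: simps)
  have P124: "P 1 2 4" by (simp add: simps)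
  have P134: "P 1 3 4" by (simp add: simps)
  have P234: "P 2 3 4" by (simp add: simps)
  have "\<forall>i j k. P i j k"
    unfolding forall_4 by (intro conjI; metis P123 P124 P134 P234 diag rot swap)
  then show ?thesis by (simp add: P_def)
qed

lemma nabla4_conformal:
  assumes x: "x \<in> M" and d: "has_pdiff e cC d x"
  shows "nabla4 g (conformal g) x $ e = d *\<^sub>R block_tensor (base x) (fibre x) (-1) 1 (-1)
    + (3 * cC x / x $ 2) *\<^sub>R
      ((\<chi> i j. fibre x $ e $ i * axis 2 1 $ j + fibre x $ e $ j * axis 2 1 $ i) \<owedge> (fibre x - base x))"
proof -
  \<comment> \<open>The block form is known on \<open>M\<close> only; openness of \<open>M\<close>
    allows its use under the derivative.\<close>
  have "nabla4 g (conformal g) x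
    = nabla4 g (\<lambda>y. block_tensor (base y) (fibre y) (- cC y) (cC y) (- cC y)) x"
    unfolding nabla4_def conformal_g[OF x]
    by (subst pdiff_cong[OF open_M x arg_cong[where f = "\<lambda>T. T $ _ $ _ $ _ $ _", OF conformal_g]]) auto
  moreover have "axis j 1 $ 2 = (axis 2 1 :: real^4) $ j" for j
    by (simp add: axis_def)
  ultimately show ?thesis
    using nabla4_block[of base fibre e cC d x g
        "(1 / x $ 2) *\<^sub>R (\<chi> i j. fibre x $ e $ i * axis 2 1 $ j + fibre x $ e $ j * axis 2 1 $ i)"]
      has_pdiff_base[OF x, of e] has_pdiff_fibre_metric[OF x, of e] d
      base_sym fibre_sym
    by (simp add: kulkarni_nomizu_scaleR_left)
qed

text \<open>The 1-form is the logarithmic differential of \<open>n = - 2 a r + 6 q + F r\<close>.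
  Since \<open>cC\<close> is \<open>n / (6 r^3)\<close>, its logarithmic differential is this form
  minus \<open>3 dr / r\<close>, and \<open>cyclic_identity\<close> cancels the \<open>dr\<close>
  term against the derivative of the block part.\<close>

lemma conformal_2_forms_recurrent_g:
  assumes N: "\<forall>x\<in>M. - 2 * a * x $ 2 + 6 * q + F x * x $ 2 \<noteq> 0"
  shows "conformal_2_forms_recurrent M g
    (\<lambda>x. vector [0, (F x - 2 * a) / (- 2 * a * x $ 2 + 6 * q + F x * x $ 2),
       pdiff 3 F x * x $ 2 / (- 2 * a * x $ 2 + 6 * q + F x * x $ 2),
       pdiff 4 F x * x $ 2 / (- 2 * a * x $ 2 + 6 * q + F x * x $ 2)])"
  unfolding conformal_2_forms_recurrent_def
proof (intro ballI allI)
  fix x i j k l m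
  assume x: "x \<in> M"
  have r: "x $ 2 \<noteq> 0"
    using x by (rule r_nonzero)
  define \<eta> :: "real^4" where "\<eta> = vector [0, (F x - 2 * a) / (- 2 * a * x $ 2 + 6 * q + F x * x $ 2),
       pdiff 3 F x * x $ 2 / (- 2 * a * x $ 2 + 6 * q + F x * x $ 2),
       pdiff 4 F x * x $ 2 / (- 2 * a * x $ 2 + 6 * q + F x * x $ 2)]"
  obtain d :: "real^4" where d: "\<And>i. has_pdiff i F (axis i 1 $ 3 * d $ 3 + axis i 1 $ 4 * d $ 4) x"
    using has_pdiff_F[OF x] by blast
  have d34: "pdiff 3 F x = d $ 3" "pdiff 4 F x = d $ 4"
    using pdiff_eqI[OF d] by simp_all
  have dC: "has_pdiff e cC (cC x * (\<eta> $ e - 3 * axis 2 1 $ e / x $ 2)) x" for e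
  proof -
    have "has_pdiff e cC (- ((2 * a * axis e 1 $ 2 - (axis e 1 $ 3 * d $ 3 + axis e 1 $ 4 * d $ 4) * x $ 2
        - F x * axis e 1 $ 2) / (6 * (x $ 2)^3)
        - (2 * a * x $ 2 - 6 * q - F x * x $ 2) * axis e 1 $ 2 / (2 * (x $ 2)^4))) x"
      unfolding cC_def[abs_def]
      by (auto intro!: has_pdiff_eq_intros d[THEN has_pdiff_eqI] simp: r field_simps eval_nat_numeral)
    moreover have eq: "\<forall>e. - ((2 * a * axis e 1 $ 2 - (axis e 1 $ 3 * d $ 3 + axis e 1 $ 4 * d $ 4) * x $ 2
        - F x * axis e 1 $ 2) / (6 * (x $ 2)^3)
        - (2 * a * x $ 2 - 6 * q - F x * x $ 2) * axis e 1 $ 2 / (2 * (x $ 2)^4))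
        = cC x * (\<eta> $ e - 3 * axis 2 1 $ e / x $ 2)"
    proof -
      define n where "n = - 2 * a * x $ 2 + 6 * q + F x * x $ 2"
      have n: "n \<noteq> 0" "cC x = n / (6 * (x $ 2)^3)"
        "2 * a * x $ 2 - 6 * q - F x * x $ 2 = - n"
        using N x by (auto simp: n_def cC_def minus_divide_left simp del: divide_minus_left)
      show ?thesis
        unfolding \<eta>_def n_def[symmetric] n(2,3) forall_4 d34
        using r n(1) by (simp add: field_simps eval_nat_numeral)
    qed
    ultimately show ?thesis
      by (blast intro: has_pdiff_eqI[OF _ eq[rule_format]])
  qed
  define Z where "Z = block_tensor (base x) (fibre x) (-1) 1 (-1)"
  define T where "T e = (\<chi> i j. fibre x $ e $ i * axis 2 1 $ j + fibre x $ e $ j * axis 2 1 $ i) \<owedge> (fibre x - base x)"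
    for e :: 4
  have C: "conformal g x = cC x *\<^sub>R Z"
    by (simp add: conformal_g[OF x] Z_def block_tensor_scaleR)
  have nabla: "nabla4 g (conformal g) x $ e
    = (cC x * (\<eta> $ e - 3 * axis 2 1 $ e / x $ 2)) *\<^sub>R Z + (3 * cC x / x $ 2) *\<^sub>R T e" for e
    unfolding nabla4_conformal[OF x dC] Z_def T_def ..
  have "(3 * cC x / x $ 2) * (axis 2 1 $ i * Z $ j $ k $ l $ m + axis 2 1 $ j * Z $ k $ i $ l $ m
        + axis 2 1 $ k * Z $ i $ j $ l $ m)
    = (3 * cC x / x $ 2) * (T i $ j $ k $ l $ m + T j $ k $ i $ l $ m + T k $ i $ j $ l $ m)"
    using cyclic_identity[of i x j k l m] by (simp add: Z_def T_def)
  then show "nabla4 g (conformal g) x $ i $ j $ k $ l $ m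
      + nabla4 g (conformal g) x $ j $ k $ i $ l $ m + nabla4 g (conformal g) x $ k $ i $ j $ l $ m
    = \<eta> $ i * conformal g x $ j $ k $ l $ m + \<eta> $ j * conformal g x $ k $ i $ l $ m
      + \<eta> $ k * conformal g x $ i $ j $ l $ m"
    unfolding nabla C by (simp add: algebra_simps)
qed

end

section \<open>Curvature identities\<close>

lemma rank_eq_2:
  fixes A :: "real^4^4"
  assumes "range (\<lambda>v. A *v v) = {v. \<forall>i. i \<notin> {j, k} \<longrightarrow> v $ i = 0}" "j \<noteq> k"
  shows "rank A = 2"
  unfolding rank_dim_range assms(1) dim_vec_eq[symmetric] dim_substandard_cart
  using assms(2) by simp

text \<open>Applied to the coordinate \<open>r\<close>, this shows that a polynomial in
  \<open>r\<close> vanishing on \<open>M\<close> is zero.\<close>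

lemma infinite_open_coordinate:
  fixes M :: "(real^'n) set"
  assumes "open M" "M \<noteq> {}"
  shows "infinite ((\<lambda>x. x $ i) ` M)"
proof -
  have "surj (\<lambda>x::real^'n. x $ i)"
    by (rule surjI[of _ "\<lambda>c. \<chi> j. c"]) simp
  then have "open ((\<lambda>x. x $ i) ` M)"
    using assms(1) by (intro open_surjective_linear_image linearI) auto
  then show ?thesis
    using assms(2) finite_imp_not_open by blast
qed

section \<open>Pseudosymmetry identities and Roter type\<close>

context robinson_trautman
begin

text \<open>The scalar is always the mixed coefficient of \<open>D\<close>: \<open>cB\<close> for
  the Riemann tensor and \<open>cC\<close> for the conformal tensor.\<close>

lemma dot_block_g:
  assumes x: "x \<in> M" and D: "D = block_tensor (base x) (fibre x) \<alpha> \<beta> \<gamma>"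
  shows "dot4 (g x) D (riemann g x) = \<beta> *\<^sub>R tachibana4 (g x) (riemann g x)"
    and "dot2 (g x) D (ricci g x) = \<beta> *\<^sub>R tachibana2 (g x) (ricci g x)"
    and "dot4 (g x) D (conformal g x) = \<beta> *\<^sub>R tachibana4 (g x) (conformal g x)"
    and "dot4 (g x) D (projective g x) = \<beta> *\<^sub>R tachibana4 (g x) (projective g x)"
    and "dot4 (g x) D (concircular g x) = \<beta> *\<^sub>R tachibana4 (g x) (concircular g x)"
    and "dot4 (g x) D (conharmonic g x) = \<beta> *\<^sub>R tachibana4 (g x) (conharmonic g x)"
proof -
  interpret metric_splitting "base x" "fibre x" "g x"
    by (rule metric_splitting[OF x])
  have block: "dot4 (g x) D H = \<beta> *\<^sub>R tachibana4 (g x) H"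
    if "H = block_tensor (base x) (fibre x) \<alpha>' \<beta>' \<gamma>'" for H \<alpha>' \<beta>' \<gamma>'
    using pseudosym4_block unfolding pseudosym4_def D that .
  show "dot4 (g x) D (riemann g x) = \<beta> *\<^sub>R tachibana4 (g x) (riemann g x)"
    by (rule block[OF riemann_g[OF x]])
  show "dot4 (g x) D (conformal g x) = \<beta> *\<^sub>R tachibana4 (g x) (conformal g x)"
    by (rule block[OF conformal_g[OF x]])
  show "dot4 (g x) D (concircular g x) = \<beta> *\<^sub>R tachibana4 (g x) (concircular g x)"
    using concircular_g[OF x] block by metis
  show "dot4 (g x) D (conharmonic g x) = \<beta> *\<^sub>R tachibana4 (g x) (conharmonic g x)"
    using conharmonic_g[OF x] block by metis
  show "dot4 (g x) D (projective g x) = \<beta> *\<^sub>R tachibana4 (g x) (projective g x)"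
    using pseudosym4_projective[OF x] unfolding pseudosym4_def D .
  show "dot2 (g x) D (ricci g x) = \<beta> *\<^sub>R tachibana2 (g x) (ricci g x)"
    using pseudosym2_block unfolding pseudosym2_def D ricci_g[OF x] .
qed

text \<open>If the scalar were a constant \<open>c\<close>, the polynomial
  \<open>q - 2 b r^2 - c r^3\<close> would have infinitely many roots, so \<open>b = q = 0\<close>.
  Conversely, the scalar is then 0.\<close>

lemma constant_type_iff:
  assumes "M \<noteq> {}"
  shows "\<not> (\<lambda>x. (q - 2 * b * (x $ 2)^2) / (x $ 2)^3) constant_on M \<longleftrightarrow> b \<noteq> 0 \<or> q \<noteq> 0"
proof -
  have "b = 0 \<and> q = 0" if const: "(\<lambda>x. (q - 2 * b * (x $ 2)^2) / (x $ 2)^3) constant_on M"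
  proof -
    obtain c where c: "\<forall>x\<in>M. (q - 2 * b * (x $ 2)^2) / (x $ 2)^3 = c"
      using const unfolding constant_on_def by (rule exE)
    have "q - 2 * b * (x $ 2)^2 = c * (x $ 2)^3" if "x \<in> M" for x
      using bspec[OF c that] r_nonzero[OF that] by (simp only: divide_eq_eq power_eq_0_iff) simp
    then have "(\<lambda>x. x $ 2) ` M \<subseteq> {t. poly [:q, 0, - 2 * b, - c:] t = 0}"
      by (auto simp: algebra_simps power2_eq_square power3_eq_cube)
    then have "infinite {t. poly [:q, 0, - 2 * b, - c:] t = 0}"
      using infinite_open_coordinate[OF open_M assms] finite_subset by blast
    then have "[:q, 0, - 2 * b, - c:] = 0"
      using poly_roots_finite by blast
    then show ?thesis by simp
  qed
  then show ?thesis
    unfolding constant_on_def by auto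
qed

text \<open>The two scalar hypotheses are the coefficients of the combination at
  \<open>Q(h, h \<owedge> k)\<close> and \<open>Q(k, h \<owedge> k)\<close>, read off from
  \<open>tachibana4_block\<close>.\<close>

lemma tachibana4_combination:
  assumes x: "x \<in> M"
    and "p1 * (cB x - 2 * cA x) + 3 * p2 * cC x + p3 * (cS x * cB x - 2 * cU x * cA x)
      + p4 * cC x * (cS x + 2 * cU x) = 0"
    and "p1 * (cB x - 2 * cD x) + 3 * p2 * cC x + p3 * (cU x * cB x - 2 * cS x * cD x)
      + p4 * cC x * (cU x + 2 * cS x) = 0"
  shows "p1 *\<^sub>R tachibana4 (g x) (riemann g x) + p2 *\<^sub>R tachibana4 (g x) (conformal g x)
    + p3 *\<^sub>R tachibana4 (ricci g x) (riemann g x) + p4 *\<^sub>R tachibana4 (ricci g x) (conformal g x) = 0"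
proof -
  define U where "U = tachibana4 (base x) (base x \<owedge> fibre x)"
  define V where "V = tachibana4 (fibre x) (base x \<owedge> fibre x)"
  have "p1 *\<^sub>R tachibana4 (g x) (riemann g x) + p2 *\<^sub>R tachibana4 (g x) (conformal g x)
    + p3 *\<^sub>R tachibana4 (ricci g x) (riemann g x) + p4 *\<^sub>R tachibana4 (ricci g x) (conformal g x)
    = (p1 * (cB x - 2 * cA x) + 3 * p2 * cC x + p3 * (cS x * cB x - 2 * cU x * cA x)
      + p4 * cC x * (cS x + 2 * cU x)) *\<^sub>R U
    + (p1 * (cB x - 2 * cD x) + 3 * p2 * cC x + p3 * (cU x * cB x - 2 * cS x * cD x)
      + p4 * cC x * (cU x + 2 * cS x)) *\<^sub>R V"
    unfolding ricci_g[OF x] riemann_g[OF x] conformal_g[OF x] g_block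
      tachibana4_block[OF base_sym fibre_sym] U_def[symmetric] V_def[symmetric]
    by (simp add: vec_eq_iff algebra_simps)
  then show ?thesis
    using assms(2,3) by simp
qed

lemma cS_eq: "x \<in> M \<Longrightarrow> cS x = 2 * cA x + 2 * cB x"
  using r_nonzero[of x] by (simp add: cS_def cA_def cB_def field_simps eval_nat_numeral)

lemma cU_eq: "cU x = 2 * cB x + 2 * cD x"
  by (simp add: cD_def)

text \<open>This is \<open>r^6\<close> times the discriminant of the quadratic form whose
  coefficients are those of the Riemann tensor, \<open>cA\<close>, \<open>cB\<close>,
  \<open>cD\<close>.\<close>

definition discr :: scalar_field where
  "discr x = 4*q*x$2*(a - 3*b*x$2) + 4*b^2*(x$2)^4 - 3*q^2 - 2*q*F x*x$2"

lemma discr_eq: "x \<in> M \<Longrightarrow> (cB x)\<^sup>2 - 4 * cA x * cD x = discr x / (x $ 2)^6"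
  using r_nonzero[of x]
  by (simp add: discr_def cA_def cB_def cD_def cU_def field_simps eval_nat_numeral)

text \<open>In terms of \<open>cA\<close>, \<open>cB\<close>, \<open>cD\<close>, both coefficients
  of \<open>cB Q(g, R) - Q(S, R)\<close> equal \<open>4 cA cD - cB^2\<close>, and both coefficients
  of \<open>Q(g, C)\<close> equal \<open>3 cC\<close>. Hence the two tensors are
  proportional.\<close>

lemma riemann_dot_riemann_minus_tachibana:
  assumes x: "x \<in> M"
  shows "((x$2)^3 * (2*a*x$2 - 6*q - F x * x$2)) *\<^sub>R
            (dot4 (g x) (riemann g x) (riemann g x) - tachibana4 (ricci g x) (riemann g x))
        = (2 * (4*a*q*x$2 + 4*b^2*(x$2)^4 - 12*b*q*(x$2)^2 - 3*q^2 - 2*q*F x*x$2)) *\<^sub>R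
            tachibana4 (g x) (conformal g x)"
proof -
  have r: "x $ 2 \<noteq> 0" by (rule r_nonzero[OF x])
  define c where "c = (x$2)^3 * (2*a*x$2 - 6*q - F x * x$2)"
  have c: "c = - 6 * (x$2)^6 * cC x"
    using r by (simp add: c_def cC_def field_simps eval_nat_numeral)
  have "(x$2)^6 * ((cB x)\<^sup>2 - 4 * cA x * cD x) = discr x"
    unfolding discr_eq[OF x] using r by simp
  then have d: "4*a*q*x$2 + 4*b^2*(x$2)^4 - 12*b*q*(x$2)^2 - 3*q^2 - 2*q*F x*x$2
     = (x$2)^6 * ((cB x)\<^sup>2 - 4 * cA x * cD x)"
    by (simp add: discr_def algebra_simps power2_eq_square)
  have "(c * cB x) *\<^sub>R tachibana4 (g x) (riemann g x)
     + (- 2 * ((x$2)^6 * ((cB x)\<^sup>2 - 4 * cA x * cD x))) *\<^sub>R tachibana4 (g x) (conformal g x)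
    + (- c) *\<^sub>R tachibana4 (ricci g x) (riemann g x) + 0 *\<^sub>R tachibana4 (ricci g x) (conformal g x) = 0"
    by (rule tachibana4_combination[OF x];
        simp add: c cS_eq[OF x] cU_eq algebra_simps power2_eq_square)
  then show ?thesis
    unfolding dot_block_g(1)[OF x riemann_g[OF x]] c_def[symmetric] d
    by (simp add: algebra_simps)
qed

text \<open>The left side is \<open>cC Q(g, R) - cB Q(g, C)\<close>. Where the discriminant is
  nonzero, \<open>Q(g, C)\<close> is a multiple of \<open>cB Q(g, R) - Q(S, R)\<close>. Substituting
  it yields \<open>quad\<close> for \<open>L2\<close> and \<open>lin\<close> for
  \<open>L1\<close>.\<close>

lemma conformal_dot_commutator_R:
  assumes x: "x \<in> M" and nz: "4*q*x$2*(a - 3*b*x$2) + 4*b^2*(x$2)^4 - 3*q^2 - 2*q*F x*x$2 \<noteq> 0"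
  shows "dot4 (g x) (conformal g x) (riemann g x) - dot4 (g x) (riemann g x) (conformal g x)
    = (- ((2*a*x$2 - 6*q - F x*x$2) * (2*(a*q + 4*b^2*(x$2)^3 - 6*b*q*x$2) - q*F x)
          / (3*(x$2)^2 * (4*q*x$2*(a - 3*b*x$2) + 4*b^2*(x$2)^4 - 3*q^2 - 2*q*F x*x$2)))) *\<^sub>R
        tachibana4 (g x) (riemann g x)
    + ((q - 2*b*(x$2)^2) * (- 2*a*x$2 + 6*q + F x*x$2)
          / (8*q*x$2*(3*b*x$2 - a) - 8*b^2*(x$2)^4 + 6*q^2 + 4*q*F x*x$2)) *\<^sub>R
        tachibana4 (ricci g x) (riemann g x)"
    (is "_ = ?L1 *\<^sub>R _ + ?L2 *\<^sub>R _")
proof -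
  have r: "x $ 2 \<noteq> 0" by (rule r_nonzero[OF x])
  define L1 where "L1 = ?L1"
  define L2 where "L2 = ?L2"
  define n where "n = 2*a*x$2 - 6*q - F x*x$2"
  have E: "discr x \<noteq> 0" using nz by (simp add: discr_def)
  have L1: "L1 = - (n * (2*(a*q + 4*b^2*(x$2)^3 - 6*b*q*x$2) - q*F x) / (3 * (x$2)^2 * discr x))"
    by (simp add: L1_def n_def discr_def)
  have "8*q*x$2*(3*b*x$2 - a) - 8*b^2*(x$2)^4 + 6*q^2 + 4*q*F x*x$2 = - 2 * discr x"
    "- 2*a*x$2 + 6*q + F x*x$2 = - n"
    by (simp_all add: discr_def n_def algebra_simps)
  then have L2: "L2 = (q - 2*b*(x$2)^2) * n / (2 * discr x)"
    by (simp add: L2_def)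
  have c: "cC x = - n / (6 * (x$2)^3)"
    unfolding cC_def n_def by (rule minus_divide_left)
  have quad: "L2 * ((cB x)\<^sup>2 - 4 * cA x * cD x) = - 3 * cC x * cB x"
    using r E by (subst discr_eq[OF x]) (simp add: L2 c cB_def field_simps eval_nat_numeral)
  have lin: "L1 = cC x - L2 * cB x"
  proof -
    define w where "w = q - 2*b*(x$2)^2"
    \<comment> \<open>Eliminating \<open>L2\<close> from \<open>lin\<close> puts the discriminant
      plus \<open>3 cB^2\<close> into the numerator of \<open>L1\<close>; up to powers of
      \<open>r\<close> this is the stated polynomial.\<close>
    have "2 * x$2 * (2*(a*q + 4*b^2*(x$2)^3 - 6*b*q*x$2) - q*F x) = discr x + 3 * w^2"
      by (simp add: discr_def w_def algebra_simps eval_nat_numeral)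
    then have X: "2*(a*q + 4*b^2*(x$2)^3 - 6*b*q*x$2) - q*F x = (discr x + 3 * w^2) / (2 * x$2)"
      using r by (simp add: nonzero_eq_divide_eq mult.commute)
    show ?thesis
      unfolding L1 L2 X c cB_def w_def[symmetric] using r E by (simp add: field_simps eval_nat_numeral)
  qed
  have "(cC x - L1) *\<^sub>R tachibana4 (g x) (riemann g x) + (- cB x) *\<^sub>R tachibana4 (g x) (conformal g x)
    + (- L2) *\<^sub>R tachibana4 (ricci g x) (riemann g x) + 0 *\<^sub>R tachibana4 (ricci g x) (conformal g x) = 0"
    by (rule tachibana4_combination[OF x]; use quad in
        \<open>simp add: lin cS_eq[OF x] cU_eq algebra_simps power2_eq_square\<close>)
  then show ?thesis
    unfolding dot_block_g(1)[OF x conformal_g[OF x]] dot_block_g(3)[OF x riemann_g[OF x]]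
      L1_def[symmetric] L2_def[symmetric]
    by (simp add: algebra_simps)
qed

text \<open>The coefficient of \<open>Q(g, C)\<close> is minus one third of the scalar curvature
  \<open>2 cS + 2 cU\<close>. With this value both scalar equations hold.\<close>

lemma conformal_dot_commutator_C:
  assumes x: "x \<in> M"
  shows "dot4 (g x) (conformal g x) (riemann g x) - dot4 (g x) (riemann g x) (conformal g x)
    = (2 * (- 2*a + 12*b*x$2 + F x) / (3*(x$2)^2)) *\<^sub>R tachibana4 (g x) (conformal g x)
      + 1 *\<^sub>R tachibana4 (ricci g x) (conformal g x)"
proof -
  have r: "x $ 2 \<noteq> 0" by (rule r_nonzero[OF x])
  define L where "L = 2 * (- 2*a + 12*b*x$2 + F x) / (3*(x$2)^2)"
  have L: "3 * L = - 2 * (cS x + cU x)"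
    using r by (simp add: L_def cS_def cU_def field_simps eval_nat_numeral)
  have "cC x *\<^sub>R tachibana4 (g x) (riemann g x) + (- cB x - L) *\<^sub>R tachibana4 (g x) (conformal g x)
    + 0 *\<^sub>R tachibana4 (ricci g x) (riemann g x) + (-1) *\<^sub>R tachibana4 (ricci g x) (conformal g x) = 0"
    using L unfolding cS_eq[OF x] cU_eq
    by (intro tachibana4_combination[OF x]; unfold cS_eq[OF x] cU_eq; algebra)
  then show ?thesis
    unfolding dot_block_g(1)[OF x conformal_g[OF x]] dot_block_g(3)[OF x riemann_g[OF x]] L_def[symmetric]
    by (simp add: algebra_simps)
qed

text \<open>The nonvanishing quantity is \<open>r^2 (cS - cU)\<close>. Then \<open>g\<close> and the
  Ricci tensor span the same plane as base and fibre metric, and comparing the three block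
  coefficients determines the decomposition.\<close>

lemma roter_type:
  assumes x: "x \<in> M" and nz: "- 2*a + 4*b*x$2 + F x \<noteq> 0"
  shows "riemann g x
    = (x$2 * (2*a*x$2 - 6*q - F x*x$2) / (2 * (- 2*a + 4*b*x$2 + F x)^2)) *\<^sub>R (ricci g x \<owedge> ricci g x)
    + ((4*a*b*(x$2)^2 + 6*a*q + 8*b^2*(x$2)^3 - F x*(2*b*(x$2)^2 + 3*q) - 36*b*q*x$2)
                  / (x$2 * (- 2*a + 4*b*x$2 + F x)^2)) *\<^sub>R (g x \<owedge> ricci g x)
    + (- (1 / (x$2)^3) * (- (4*b*x$2 * (6*a*q + 8*b^2*(x$2)^3 - 24*b*q*x$2 - 3*q*F x)
                        / (- 2*a + 4*b*x$2 + F x)^2) + q)) *\<^sub>R (g x \<owedge> g x)"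
proof -
  have r: "x $ 2 \<noteq> 0" by (rule r_nonzero[OF x])
  define n where "n = - 2*a + 4*b*x$2 + F x"
  have F: "F x = n + 2*a - 4*b*x$2" and n: "n \<noteq> 0"
    using nz by (simp_all add: n_def)
  show ?thesis
    unfolding ricci_g[OF x] riemann_g[OF x] g_block kulkarni_nomizu_block block_tensor_scaleR block_tensor_add
      n_def[symmetric]
    by (rule block_tensor_cong; use r n in \<open>simp add: F cA_def cB_def cD_def cS_def cU_def
       field_simps eval_nat_numeral\<close>)
qed

section \<open>Rank and quasi-Einstein decompositions of the Ricci tensor\<close>

lemma rank_scaleR_base: "c \<noteq> 0 \<Longrightarrow> rank (c *\<^sub>R base x) = 2"
proof (rule rank_eq_2)
  assume c: "c \<noteq> 0"
  show "range (\<lambda>v. (c *\<^sub>R base x) *v v) = {v. \<forall>i. i \<notin> {1, 2} \<longrightarrow> v $ i = 0}"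
  proof (intro equalityI subsetI)
    fix v :: "real^4" assume v: "v \<in> {v. \<forall>i. i \<notin> {1, 2} \<longrightarrow> v $ i = 0}"
    \<comment> \<open>The preimage solves the 2 by 2 system of the base block.\<close>
    have "v = (c *\<^sub>R base x) *v vector [v $ 2 / c, (v $ 1 - g11 x * v $ 2) / c, 0, 0]"
      using v c by (simp add: vec_eq_iff forall_4 matrix_vector_mult_def sum_4 base_def field_simps)
    then show "v \<in> range (\<lambda>v. (c *\<^sub>R base x) *v v)" by blast
  qed (auto simp: forall_4 matrix_vector_mult_def sum_4 base_def)
qed simp

lemma rank_scaleR_fibre: "x \<in> M \<Longrightarrow> c \<noteq> 0 \<Longrightarrow> rank (c *\<^sub>R fibre x) = 2"
proof (rule rank_eq_2)
  assume c: "c \<noteq> 0" and x: "x \<in> M"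
  have k: "g33 x \<noteq> 0"
    using r_nonzero[OF x] f0_nonzero[OF x] by (simp add: g33_def)
  show "range (\<lambda>v. (c *\<^sub>R fibre x) *v v) = {v. \<forall>i. i \<notin> {3, 4} \<longrightarrow> v $ i = 0}"
  proof (intro equalityI subsetI)
    fix v :: "real^4" assume v: "v \<in> {v. \<forall>i. i \<notin> {3, 4} \<longrightarrow> v $ i = 0}"
    have "v = (c *\<^sub>R fibre x) *v vector [0, 0, v $ 3 / (c * g33 x), v $ 4 / (c * g33 x)]"
      using v c k by (simp add: vec_eq_iff forall_4 matrix_vector_mult_def sum_4 fibre_def field_simps)
    then show "v \<in> range (\<lambda>v. (c *\<^sub>R fibre x) *v v)" by blast
  qed (auto simp: forall_4 matrix_vector_mult_def sum_4 fibre_def)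
qed simp

text \<open>The two choices of \<open>\<alpha>\<close> are \<open>cU\<close> and \<open>cS\<close>.
  Subtracting one of them leaves a multiple of a single block, with factor \<open>cS - cU\<close> up
  to sign; where the two coincide the rank drops to 0.\<close>

lemma rank_ricci_minus:
  assumes x: "x \<in> M" and \<alpha>: "\<alpha> \<in> {\<lambda>x. (2*a - 8*b*x$2 - F x) / (x$2)^2, \<lambda>x. - (4*b / x$2)}"
  shows "rank (ricci g x - \<alpha> x *\<^sub>R g x) \<le> 2 \<and>
    (rank (ricci g x - \<alpha> x *\<^sub>R g x) = 2 \<longleftrightarrow> - 2*a + 4*b*x$2 + F x \<noteq> 0)"
proof -
  define c where "c = (- 2*a + 4*b*x$2 + F x) / (x$2)^2"
  have c: "c = cS x - cU x" "c = 0 \<longleftrightarrow> - 2*a + 4*b*x$2 + F x = 0"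
    using r_nonzero[OF x] by (simp_all add: c_def cS_def cU_def field_simps eval_nat_numeral)
  have "ricci g x - \<alpha> x *\<^sub>R g x = c *\<^sub>R base x \<or> ricci g x - \<alpha> x *\<^sub>R g x = (- c) *\<^sub>R fibre x"
    using \<alpha> by (auto simp: ricci_g[OF x] c(1) g_eq cS_def cU_def algebra_simps)
  then show ?thesis
    using rank_scaleR_base[of c x] rank_scaleR_fibre[OF x, of "- c"] c(2) by (cases "c = 0") auto
qed

lemma two_quasi_einstein_g: "two_quasi_einstein M g"
  unfolding two_quasi_einstein_def using rank_ricci_minus by blast

lemma form_inner_g:
  assumes x: "x \<in> M"
  shows "form_inner (g x) \<eta> \<Phi> = \<eta> $ 1 * \<Phi> $ 2 + \<eta> $ 2 * \<Phi> $ 1 - g11 x * \<eta> $ 2 * \<Phi> $ 2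
    - (f0 x)\<^sup>2 / (x $ 2)\<^sup>2 * (\<eta> $ 3 * \<Phi> $ 3 + \<eta> $ 4 * \<Phi> $ 4)"
  by (simp add: form_inner_def matrix_inv_g[OF x] ginv_def sum_4 algebra_simps)

text \<open>Removing \<open>cU g\<close> leaves a multiple of the base metric. Its component 2, 2
  vanishes, so it is a combination of \<open>\<Phi> \<otimes> \<Phi>\<close> and the symmetric
  product of \<open>\<Phi>\<close> with \<open>\<eta>\<close>. The factor \<open>\<beta>\<close>
  thus belongs to \<open>\<Phi>\<close>, and the order of the two forms in \<open>chaki_for\<close>
  matters.\<close>

lemma chaki_g:
  assumes \<phi>1: "\<forall>x\<in>M. \<phi>1 x \<noteq> 0"
  defines "\<alpha> \<equiv> \<lambda>x. - ((- 2*a + 8*b*x$2 + F x) / (x$2)^2)"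
    and "\<beta> \<equiv> \<lambda>x. 4*b * (- 2*a + 4*b*x$2 + F x) / ((\<phi>1 x)^2 * x$2)"
    and "\<gamma> \<equiv> \<lambda>x. - 2*a + 4*b*x$2 + F x"
    and "\<eta> \<equiv> \<lambda>x. vector [(q - a*x$2) / (\<phi>1 x * (x$2)^3), 1 / (\<phi>1 x * (x$2)^2), 0, 0]"
    and "\<Phi> \<equiv> \<lambda>x. vector [\<phi>1 x, 0, 0, 0]"
  shows "chaki_for M g \<alpha> \<beta> \<gamma> \<Phi> \<eta>"
    and "chaki_for M g \<alpha> \<beta> \<gamma> \<eta> \<Phi> \<longleftrightarrow> (\<forall>x\<in>M. b * (- 2*a + 4*b*x$2 + F x) = 0)"
    and "\<forall>x\<in>M. form_inner (g x) (\<eta> x) (\<eta> x) = - (4*b / ((\<phi>1 x)^2 * (x$2)^3))"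
    and "\<forall>x\<in>M. form_inner (g x) (\<Phi> x) (\<Phi> x) = 0"
proof -
  have decomp: "ricci g x = \<alpha> x *\<^sub>R g x + \<beta> x *\<^sub>R form_prod (\<Phi> x) (\<Phi> x)
      + \<gamma> x *\<^sub>R (form_prod (\<Phi> x) (\<eta> x) + form_prod (\<eta> x) (\<Phi> x))" if x: "x \<in> M" for x
  proof -
    have r: "x $ 2 \<noteq> 0" and p: "\<phi>1 x \<noteq> 0"
      using x r_nonzero \<phi>1 by auto
    have \<alpha>: "\<alpha> x = cU x"
      using r by (simp add: \<alpha>_def cU_def field_simps)
    have S: "cS x = cU x + \<gamma> x / (x$2)^2"
      using r by (simp add: cS_def cU_def \<gamma>_def field_simps eval_nat_numeral)
    have \<beta>: "\<beta> x = 4 * b * \<gamma> x / ((\<phi>1 x)^2 * x$2)"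
      by (simp add: \<beta>_def \<gamma>_def)
    show ?thesis
      unfolding ricci_g[OF x] \<alpha> S \<beta>
      using r p
      by (simp add: vec_eq_iff forall_4 g_eq_vector base_def fibre_def form_prod_def \<Phi>_def \<eta>_def g11_def
          field_simps eval_nat_numeral)
  qed
  then show "chaki_for M g \<alpha> \<beta> \<gamma> \<Phi> \<eta>"
    by (simp add: chaki_for_def)
  show "chaki_for M g \<alpha> \<beta> \<gamma> \<eta> \<Phi> \<longleftrightarrow> (\<forall>x\<in>M. b * (- 2*a + 4*b*x$2 + F x) = 0)"
    unfolding chaki_for_def
  proof (rule ball_cong[OF refl])
    fix x assume x: "x \<in> M"
    have r: "x $ 2 \<noteq> 0" and p: "\<phi>1 x \<noteq> 0"
      using x r_nonzero \<phi>1 by auto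
    have "ricci g x = \<alpha> x *\<^sub>R g x + \<beta> x *\<^sub>R form_prod (\<eta> x) (\<eta> x)
      + \<gamma> x *\<^sub>R (form_prod (\<eta> x) (\<Phi> x) + form_prod (\<Phi> x) (\<eta> x))
      \<longleftrightarrow> \<beta> x *\<^sub>R form_prod (\<Phi> x) (\<Phi> x) = \<beta> x *\<^sub>R form_prod (\<eta> x) (\<eta> x)"
      unfolding decomp[OF x] by (simp add: algebra_simps)
    also have "\<dots> \<longleftrightarrow> \<beta> x = 0"
    proof
      assume "\<beta> x *\<^sub>R form_prod (\<Phi> x) (\<Phi> x) = \<beta> x *\<^sub>R form_prod (\<eta> x) (\<eta> x)"
      \<comment> \<open>Component 2, 2 separates the two products: \<open>\<Phi> x $ 2\<close> is 0
        and \<open>\<eta> x $ 2\<close> is not.\<close>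
      then have "(\<beta> x *\<^sub>R form_prod (\<Phi> x) (\<Phi> x)) $ 2 $ 2 = (\<beta> x *\<^sub>R form_prod (\<eta> x) (\<eta> x)) $ 2 $ 2"
        by (rule arg_cong)
      then show "\<beta> x = 0"
        using r p by (simp add: form_prod_def \<Phi>_def \<eta>_def)
    qed simp
    also have "\<dots> \<longleftrightarrow> b * (- 2*a + 4*b*x$2 + F x) = 0"
      using r p by (simp add: \<beta>_def)
    finally show "ricci g x = \<alpha> x *\<^sub>R g x + \<beta> x *\<^sub>R form_prod (\<eta> x) (\<eta> x)
      + \<gamma> x *\<^sub>R (form_prod (\<eta> x) (\<Phi> x) + form_prod (\<Phi> x) (\<eta> x))
      \<longleftrightarrow> b * (- 2*a + 4*b*x$2 + F x) = 0" .
  qed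
  show "\<forall>x\<in>M. form_inner (g x) (\<eta> x) (\<eta> x) = - (4*b / ((\<phi>1 x)^2 * (x$2)^3))"
  proof
    fix x assume x: "x \<in> M"
    have r: "x $ 2 \<noteq> 0" and p: "\<phi>1 x \<noteq> 0"
      using x r_nonzero \<phi>1 by auto
    then show "form_inner (g x) (\<eta> x) (\<eta> x) = - (4*b / ((\<phi>1 x)^2 * (x$2)^3))"
      by (simp add: form_inner_g[OF x] \<eta>_def g11_def field_simps eval_nat_numeral)
  qed
  show "\<forall>x\<in>M. form_inner (g x) (\<Phi> x) (\<Phi> x) = 0"
    by (simp add: form_inner_g \<Phi>_def)
qed

text \<open>Removing \<open>cS g\<close> leaves a multiple of the fibre metric, which is minus the
  sum of the squares of the two 1-forms.\<close>

lemma de_ghosh_g: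
  "de_ghosh_for M g (\<lambda>x. - (4*b / x$2)) (\<lambda>x. (- 2*a + 4*b*x$2 + F x) / (x$2)^2)
    (\<lambda>x. (- 2*a + 4*b*x$2 + F x) / (x$2)^2)
    (\<lambda>x. vector [0, 0, x$2 / f (x$3, x$4), 0]) (\<lambda>x. vector [0, 0, 0, x$2 / f (x$3, x$4)])"
  unfolding de_ghosh_for_def
proof
  fix x assume x: "x \<in> M"
  have r: "x $ 2 \<noteq> 0" and f: "f0 x \<noteq> 0"
    using x r_nonzero f0_nonzero by auto
  define c where "c = (- 2*a + 4*b*x$2 + F x) / (x$2)^2"
  have U: "cU x = - (4*b / x$2) - c" and S: "cS x = - (4*b / x$2)"
    using r by (simp_all add: c_def cS_def cU_def field_simps eval_nat_numeral)
  show "ricci g x = (- (4*b / x$2)) *\<^sub>R g x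
      + ((- 2*a + 4*b*x$2 + F x) / (x$2)^2) *\<^sub>R
        form_prod (vector [0, 0, x$2 / f (x$3, x$4), 0]) (vector [0, 0, x$2 / f (x$3, x$4), 0])
      + ((- 2*a + 4*b*x$2 + F x) / (x$2)^2) *\<^sub>R
        form_prod (vector [0, 0, 0, x$2 / f (x$3, x$4)]) (vector [0, 0, 0, x$2 / f (x$3, x$4)])"
    unfolding ricci_g[OF x] c_def[symmetric] f0_def[symmetric] S U
    by (simp add: vec_eq_iff forall_4 g_eq_vector base_def fibre_def form_prod_def g33_def
        algebra_simps power2_eq_square)
qed

lemma de_ghosh_forms_g:
  assumes x: "x \<in> M"
  shows "form_inner (g x) (vector [0, 0, x$2 / f (x$3, x$4), 0]) (vector [0, 0, x$2 / f (x$3, x$4), 0]) = - 1"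
    "form_inner (g x) (vector [0, 0, 0, x$2 / f (x$3, x$4)]) (vector [0, 0, 0, x$2 / f (x$3, x$4)]) = - 1"
    "form_inner (g x) (vector [0, 0, x$2 / f (x$3, x$4), 0]) (vector [0, 0, 0, x$2 / f (x$3, x$4)]) = 0"
  using r_nonzero[OF x] f_nonzero[OF x]
  by (simp_all add: form_inner_g[OF x] f0_def power2_eq_square)

text \<open>The remainder \<open>E\<close> is determined by the other data. The 1-form has norm -1,
  whence the sign of \<open>\<beta>\<close> in the trace, and its associated vector is an
  eigenvector of \<open>E\<close>, so each condition is a single scalar equation.\<close>

lemma pseudo_quasi_einstein_remainder:
  fixes E :: tensor2 and \<alpha> \<beta> :: real
  assumes x: "x \<in> M"
  defines "\<eta> \<equiv> vector [0, 0, 0, x$2 / f (x$3, x$4)]"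
  assumes E: "ricci g x = \<alpha> *\<^sub>R g x + \<beta> *\<^sub>R form_prod \<eta> \<eta> + 1 *\<^sub>R E"
  shows "metric_trace (g x) E = 2 * cS x + 2 * cU x - 4 * \<alpha> + \<beta>"
    and "E *v (matrix_inv (g x) *v \<eta>) = 0 \<longleftrightarrow> cU x - \<alpha> + \<beta> = 0"
proof -
  have r: "x $ 2 \<noteq> 0" and f: "f0 x \<noteq> 0"
    using x r_nonzero f0_nonzero by auto
  have \<eta>: "\<eta> = vector [0, 0, 0, x$2 / f0 x]"
    by (simp add: \<eta>_def f0_def)
  have E': "E = (cS x - \<alpha>) *\<^sub>R base x + (cU x - \<alpha>) *\<^sub>R fibre x - \<beta> *\<^sub>R form_prod \<eta> \<eta>"
    using E unfolding ricci_g[OF x] g_eq by (simp add: algebra_simps)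
  show "metric_trace (g x) E = 2 * cS x + 2 * cU x - 4 * \<alpha> + \<beta>"
    using r f by (simp add: metric_trace_g[OF x] E' \<eta> form_prod_def base_def fibre_def g33_def field_simps
        power2_eq_square)
  have "E *v (matrix_inv (g x) *v \<eta>) = vector [0, 0, 0, (cU x - \<alpha> + \<beta>) * (x$2 / f0 x)]"
    using r f by (simp add: matrix_inv_g[OF x] E' \<eta> form_prod_def base_def fibre_def g33_def ginv_def
        vec_eq_iff forall_4 matrix_vector_mult_def sum_4 field_simps power2_eq_square)
  then show "E *v (matrix_inv (g x) *v \<eta>) = 0 \<longleftrightarrow> cU x - \<alpha> + \<beta> = 0"
    using r f by (simp add: vec_eq_iff forall_4)
qed

lemma trace_free_decomposition_g:
  assumes "\<forall>x\<in>M. 2 * cS x + 2 * cU x - 4 * \<alpha> x + \<beta> x = 0"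
  shows "\<exists>E. \<forall>x\<in>M. ricci g x = \<alpha> x *\<^sub>R g x
      + \<beta> x *\<^sub>R form_prod (vector [0, 0, 0, x$2 / f (x$3, x$4)]) (vector [0, 0, 0, x$2 / f (x$3, x$4)])
      + 1 *\<^sub>R E x \<and> metric_trace (g x) (E x) = 0"
proof -
  define E where "E x = ricci g x - \<alpha> x *\<^sub>R g x
      - \<beta> x *\<^sub>R form_prod (vector [0, 0, 0, x$2 / f (x$3, x$4)]) (vector [0, 0, 0, x$2 / f (x$3, x$4)])" for x
  have E: "ricci g x = \<alpha> x *\<^sub>R g x
      + \<beta> x *\<^sub>R form_prod (vector [0, 0, 0, x$2 / f (x$3, x$4)]) (vector [0, 0, 0, x$2 / f (x$3, x$4)])
      + 1 *\<^sub>R E x" for x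
    by (simp add: E_def)
  show ?thesis
    using E pseudo_quasi_einstein_remainder(1)[OF _ E] assms by (intro exI[of _ E]) simp
qed

lemma pseudo_quasi_einstein_for_iff:
  assumes tr: "\<forall>x\<in>M. 2 * cS x + 2 * cU x - 4 * \<alpha> x + \<beta> x = 0"
  shows "pseudo_quasi_einstein_for M g \<alpha> \<beta> (\<lambda>x. 1) (\<lambda>x. vector [0, 0, 0, x$2 / f (x$3, x$4)])
    \<longleftrightarrow> (\<forall>x\<in>M. cU x - \<alpha> x + \<beta> x = 0)"
  unfolding pseudo_quasi_einstein_for_def
proof
  assume "\<forall>x\<in>M. cU x - \<alpha> x + \<beta> x = 0"
  then show "\<exists>E. \<forall>x\<in>M. ricci g x = \<alpha> x *\<^sub>R g x
      + \<beta> x *\<^sub>R form_prod (vector [0, 0, 0, x$2 / f (x$3, x$4)]) (vector [0, 0, 0, x$2 / f (x$3, x$4)])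
      + 1 *\<^sub>R E x \<and> metric_trace (g x) (E x) = 0
      \<and> E x *v (matrix_inv (g x) *v vector [0, 0, 0, x$2 / f (x$3, x$4)]) = 0"
    using trace_free_decomposition_g[OF tr] pseudo_quasi_einstein_remainder(2) by meson
qed (use pseudo_quasi_einstein_remainder(2) in meson)

text \<open>The first pair of scalars meets the trace condition everywhere, while annihilation of
  the associated vector amounts to \<open>4 a - 32 b r + F = 0\<close>. Solving both conditions
  gives \<open>\<alpha> = (2 cS + cU) / 3\<close> and \<open>\<beta> = 2 (cS - cU) / 3\<close>, the
  second pair.\<close>

lemma pseudo_quasi_einstein_g:
  fixes \<gamma> :: scalar_field
  defines "\<alpha> \<equiv> \<lambda>x. - (F x / (2 * (x$2)^2))" and "\<beta> \<equiv> \<lambda>x. - (4 * (a - 6*b*x$2) / (x$2)^2)"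
    and "\<gamma> \<equiv> \<lambda>x. 1" and "\<eta> \<equiv> \<lambda>x. vector [0, 0, 0, x$2 / f (x$3, x$4)]"
  shows "\<exists>E. \<forall>x\<in>M. ricci g x = \<alpha> x *\<^sub>R g x + \<beta> x *\<^sub>R form_prod (\<eta> x) (\<eta> x) + \<gamma> x *\<^sub>R E x
      \<and> metric_trace (g x) (E x) = 0"
    and "pseudo_quasi_einstein_for M g \<alpha> \<beta> \<gamma> \<eta> \<longleftrightarrow> (\<forall>x\<in>M. 4*a - 32*b*x$2 + F x = 0)"
    and "pseudo_quasi_einstein_for M g (\<lambda>x. (2*a - 16*b*x$2 - F x) / (3 * (x$2)^2))
           (\<lambda>x. 2 * (- 2*a + 4*b*x$2 + F x) / (3 * (x$2)^2)) \<gamma> \<eta>"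
proof -
  have tr: "\<forall>x\<in>M. 2 * cS x + 2 * cU x - 4 * \<alpha> x + \<beta> x = 0"
    using r_nonzero by (simp add: \<alpha>_def \<beta>_def cS_def cU_def field_simps eval_nat_numeral)
  show "\<exists>E. \<forall>x\<in>M. ricci g x = \<alpha> x *\<^sub>R g x + \<beta> x *\<^sub>R form_prod (\<eta> x) (\<eta> x) + \<gamma> x *\<^sub>R E x
      \<and> metric_trace (g x) (E x) = 0"
    unfolding \<gamma>_def \<eta>_def by (rule trace_free_decomposition_g[OF tr])
  have "cU x - \<alpha> x + \<beta> x = 0 \<longleftrightarrow> 4*a - 32*b*x$2 + F x = 0" if "x \<in> M" for x
  proof -
    have "cU x - \<alpha> x + \<beta> x = (4*a - 32*b*x$2 + F x) * (- 1 / (2 * (x$2)^2))"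
      using r_nonzero[OF that] by (simp add: \<alpha>_def \<beta>_def cU_def field_simps)
    then show ?thesis
      using r_nonzero[OF that] by simp
  qed
  then show "pseudo_quasi_einstein_for M g \<alpha> \<beta> \<gamma> \<eta> \<longleftrightarrow> (\<forall>x\<in>M. 4*a - 32*b*x$2 + F x = 0)"
    unfolding \<gamma>_def \<eta>_def pseudo_quasi_einstein_for_iff[OF tr] by (rule ball_cong[OF refl])
  have "\<forall>x\<in>M. 2 * cS x + 2 * cU x - 4 * ((2*a - 16*b*x$2 - F x) / (3 * (x$2)^2))
      + 2 * (- 2*a + 4*b*x$2 + F x) / (3 * (x$2)^2) = 0"
    using r_nonzero by (simp add: cS_def cU_def field_simps eval_nat_numeral)
  moreover have "\<forall>x\<in>M. cU x - (2*a - 16*b*x$2 - F x) / (3 * (x$2)^2)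
      + 2 * (- 2*a + 4*b*x$2 + F x) / (3 * (x$2)^2) = 0"
    using r_nonzero by (simp add: cU_def field_simps)
  ultimately show "pseudo_quasi_einstein_for M g (\<lambda>x. (2*a - 16*b*x$2 - F x) / (3 * (x$2)^2))
           (\<lambda>x. 2 * (- 2*a + 4*b*x$2 + F x) / (3 * (x$2)^2)) \<gamma> \<eta>"
    unfolding \<gamma>_def \<eta>_def by (subst pseudo_quasi_einstein_for_iff)
qed

section \<open>Compatible tensors and 1-forms\<close>

lemma compatible_block_form:
  assumes D: "\<And>x. x \<in> M \<Longrightarrow> \<exists>\<alpha> \<beta> \<gamma>. D x = block_tensor (base x) (fibre x) \<alpha> \<beta> \<gamma>"
    and T: "\<And>x. x \<in> M \<Longrightarrow> \<exists>t11 t12 t22 t33 t34 t44. T x = vector [vector [t11, t12, 0, 0],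
      vector [t12, t22, 0, 0], vector [0, 0, t33, t34], vector [0, 0, t34, t44]]"
  shows "compatible M g D T"
  unfolding compatible_def
proof (intro ballI allI)
  fix x i j k l
  assume x: "x \<in> M"
  have r: "x $ 2 \<noteq> 0" and f: "f0 x \<noteq> 0"
    using x r_nonzero f0_nonzero by auto
  interpret metric_splitting "base x" "fibre x" "g x"
    by (rule metric_splitting[OF x])
  obtain \<alpha> \<beta> \<gamma> where D': "D x = block_tensor (base x) (fibre x) \<alpha> \<beta> \<gamma>"
    using D[OF x] by blast
  obtain t11 t12 t22 t33 t34 t44 where T': "T x = vector [vector [t11, t12, 0, 0],
      vector [t12, t22, 0, 0], vector [0, 0, t33, t34], vector [0, 0, t34, t44]]"
    using T[OF x] by blast
  \<comment> \<open>These products are the base block and the fibre block of \<open>T x\<close>,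
    both symmetric.\<close>
  have "\<forall>i j. (T x ** ginv x ** base x) $ i $ j = (T x ** ginv x ** base x) $ j $ i"
    "\<forall>i j. (T x ** ginv x ** fibre x) $ i $ j = (T x ** ginv x ** fibre x) $ j $ i"
    using r f by (simp_all add: forall_4 T' matrix_matrix_mult_def sum_4 base_def fibre_def ginv_def g33_def)
  then show "(\<Sum>m\<in>UNIV. raise2 (g x) (T x) i $ m * D x $ m $ l $ j $ k
                 + raise2 (g x) (T x) j $ m * D x $ m $ l $ k $ i
                 + raise2 (g x) (T x) k $ m * D x $ m $ l $ i $ j) = 0"
    unfolding D' by (intro block_compatible) (simp_all only: matrix_inv_g[OF x])
qed

lemma curvature_block_forms:
  assumes x: "x \<in> M"
  shows "\<exists>\<alpha> \<beta> \<gamma>. riemann g x = block_tensor (base x) (fibre x) \<alpha> \<beta> \<gamma>"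
    "\<exists>\<alpha> \<beta> \<gamma>. conformal g x = block_tensor (base x) (fibre x) \<alpha> \<beta> \<gamma>"
    "\<exists>\<alpha> \<beta> \<gamma>. concircular g x = block_tensor (base x) (fibre x) \<alpha> \<beta> \<gamma>"
    "\<exists>\<alpha> \<beta> \<gamma>. conharmonic g x = block_tensor (base x) (fibre x) \<alpha> \<beta> \<gamma>"
  using riemann_g[OF x] conformal_g[OF x] concircular_g[OF x] conharmonic_g[OF x] by metis+

lemma ricci_block_form:
  assumes x: "x \<in> M"
  shows "\<exists>t11 t12 t22 t33 t34 t44. ricci g x = vector [vector [t11, t12, 0, 0],
      vector [t12, t22, 0, 0], vector [0, 0, t33, t34], vector [0, 0, t34, t44]]"
proof -
  have "ricci g x = vector [vector [cS x * g11 x, cS x, 0, 0], vector [cS x, 0, 0, 0],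
      vector [0, 0, cU x * g33 x, 0], vector [0, 0, 0, cU x * g33 x]]"
    by (simp add: ricci_g[OF x] vec_eq_iff forall_4 base_def fibre_def)
  then show ?thesis by blast
qed

text \<open>The square of a 1-form with a single component is diagonal, so it has no mixed
  base-fibre entries.\<close>

lemma form_compatible_axis:
  assumes D: "\<And>x. x \<in> M \<Longrightarrow> \<exists>\<alpha> \<beta> \<gamma>. D x = block_tensor (base x) (fibre x) \<alpha> \<beta> \<gamma>"
    and \<eta>: "\<eta> \<in> {\<lambda>x. vector [t x, 0, 0, 0], \<lambda>x. vector [0, t x, 0, 0],
               \<lambda>x. vector [0, 0, t x, 0], \<lambda>x. vector [0, 0, 0, t x]}"
  shows "form_compatible M g D \<eta>"
  unfolding form_compatible_def
proof (rule compatible_block_form[OF D])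
  fix x
  have "form_prod (\<eta> x) (\<eta> x) = vector [vector [(\<eta> x $ 1)\<^sup>2, 0, 0, 0], vector [0, (\<eta> x $ 2)\<^sup>2, 0, 0],
     vector [0, 0, (\<eta> x $ 3)\<^sup>2, 0], vector [0, 0, 0, (\<eta> x $ 4)\<^sup>2]]"
    using \<eta> by (auto simp: form_prod_def vec_eq_iff forall_4 power2_eq_square)
  then show "\<exists>t11 t12 t22 t33 t34 t44. form_prod (\<eta> x) (\<eta> x) = vector [vector [t11, t12, 0, 0],
      vector [t12, t22, 0, 0], vector [0, 0, t33, t34], vector [0, 0, t34, t44]]"
    by blast
qed

end

theorem theorem4p1:
  fixes a b q :: real
    and f :: "real \<times> real \<Rightarrow> real"
    and M :: "(real^4) set"
  assumes "open M" and "connected M" and "M \<noteq> {}"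
    and "\<forall>x\<in>M. x$2 \<noteq> 0"
    and "smooth_on ((\<lambda>x. (x$3, x$4)) ` M) f"
    and "\<forall>z\<in>(\<lambda>x. (x$3, x$4)) ` M. f z \<noteq> 0"
  shows
    "let g = rt_metric a b q f; F = rt_F f; r = (\<lambda>x::real^4. x$2);
         R = riemann g; S = ricci g;
         C = conformal g; P = projective g; W = concircular g; K = conharmonic g
     in
     \<comment> \<open>(i)\<close>
     (let L = (\<lambda>x. (q - 2*b*(r x)^2) / (r x)^3) in
        (\<forall>x\<in>M. dot4 (g x) (R x) (R x) = L x *\<^sub>R tachibana4 (g x) (R x)) \<and>
        (\<forall>x\<in>M. dot2 (g x) (R x) (S x) = L x *\<^sub>R tachibana2 (g x) (S x)) \<and>
        (\<forall>x\<in>M. dot4 (g x) (R x) (C x) = L x *\<^sub>R tachibana4 (g x) (C x)) \<and>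
        (\<forall>x\<in>M. dot4 (g x) (R x) (P x) = L x *\<^sub>R tachibana4 (g x) (P x)) \<and>
        (\<forall>x\<in>M. dot4 (g x) (R x) (W x) = L x *\<^sub>R tachibana4 (g x) (W x)) \<and>
        (\<forall>x\<in>M. dot4 (g x) (R x) (K x) = L x *\<^sub>R tachibana4 (g x) (K x)) \<and>
        (\<not> L constant_on M \<longleftrightarrow> b \<noteq> 0 \<or> q \<noteq> 0)) \<and>
     \<comment> \<open>(ii)\<close>
     (\<forall>x\<in>M. ((r x)^3 * (2*a*r x - 6*q - F x * r x)) *\<^sub>R
                (dot4 (g x) (R x) (R x) - tachibana4 (S x) (R x))
            = (2 * (4*a*q*r x + 4*b^2*(r x)^4 - 12*b*q*(r x)^2 - 3*q^2 - 2*q*F x*r x)) *\<^sub>R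
                tachibana4 (g x) (C x)) \<and>
     \<comment> \<open>(iii)\<close>
     (let L = (\<lambda>x. - ((2*a*r x - 6*q - F x * r x) / (6 * (r x)^3))) in
        (\<forall>x\<in>M. dot4 (g x) (C x) (R x) = L x *\<^sub>R tachibana4 (g x) (R x)) \<and>
        (\<forall>x\<in>M. dot2 (g x) (C x) (S x) = L x *\<^sub>R tachibana2 (g x) (S x)) \<and>
        (\<forall>x\<in>M. dot4 (g x) (C x) (C x) = L x *\<^sub>R tachibana4 (g x) (C x)) \<and>
        (\<forall>x\<in>M. dot4 (g x) (C x) (W x) = L x *\<^sub>R tachibana4 (g x) (W x)) \<and>
        (\<forall>x\<in>M. dot4 (g x) (C x) (P x) = L x *\<^sub>R tachibana4 (g x) (P x)) \<and>
        (\<forall>x\<in>M. dot4 (g x) (C x) (K x) = L x *\<^sub>R tachibana4 (g x) (K x))) \<and>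
     \<comment> \<open>(iv)\<close>
     ((\<forall>x\<in>M. 4*q*r x*(a - 3*b*r x) + 4*b^2*(r x)^4 - 3*q^2 - 2*q*F x*r x \<noteq> 0) \<longrightarrow>
      (let L1 = (\<lambda>x. - ((2*a*r x - 6*q - F x*r x) * (2*(a*q + 4*b^2*(r x)^3 - 6*b*q*r x) - q*F x)
                  / (3*(r x)^2 * (4*q*r x*(a - 3*b*r x) + 4*b^2*(r x)^4 - 3*q^2 - 2*q*F x*r x))));
           L2 = (\<lambda>x. (q - 2*b*(r x)^2) * (- 2*a*r x + 6*q + F x*r x)
                  / (8*q*r x*(3*b*r x - a) - 8*b^2*(r x)^4 + 6*q^2 + 4*q*F x*r x))
       in \<forall>x\<in>M. dot4 (g x) (C x) (R x) - dot4 (g x) (R x) (C x)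
            = L1 x *\<^sub>R tachibana4 (g x) (R x) + L2 x *\<^sub>R tachibana4 (S x) (R x))) \<and>
     \<comment> \<open>(v)\<close>
     (let L1 = (\<lambda>x. 2 * (- 2*a + 12*b*r x + F x) / (3*(r x)^2)); L2 = (\<lambda>x. 1)
      in \<forall>x\<in>M. dot4 (g x) (C x) (R x) - dot4 (g x) (R x) (C x)
            = L1 x *\<^sub>R tachibana4 (g x) (C x) + L2 x *\<^sub>R tachibana4 (S x) (C x)) \<and>
     \<comment> \<open>(vi)\<close>
     ((\<forall>x\<in>M. - 2*a*r x + 6*q + F x*r x \<noteq> 0) \<longrightarrow>
      conformal_2_forms_recurrent M g
        (\<lambda>x. vector [0,
                     (F x - 2*a) / (- 2*a*r x + 6*q + F x*r x),
                     pdiff 3 F x * r x / (- 2*a*r x + 6*q + F x*r x),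
                     pdiff 4 F x * r x / (- 2*a*r x + 6*q + F x*r x)])) \<and>
     \<comment> \<open>(vii)\<close>
     ((\<forall>x\<in>M. - 2*a + 4*b*r x + F x \<noteq> 0) \<longrightarrow>
      (let N1 = (\<lambda>x. r x * (2*a*r x - 6*q - F x*r x) / (2 * (- 2*a + 4*b*r x + F x)^2));
           N2 = (\<lambda>x. (4*a*b*(r x)^2 + 6*a*q + 8*b^2*(r x)^3 - F x*(2*b*(r x)^2 + 3*q) - 36*b*q*r x)
                  / (r x * (- 2*a + 4*b*r x + F x)^2));
           N3 = (\<lambda>x. - (1 / (r x)^3) *
                  (- (4*b*r x * (6*a*q + 8*b^2*(r x)^3 - 24*b*q*r x - 3*q*F x)
                        / (- 2*a + 4*b*r x + F x)^2) + q))
       in \<forall>x\<in>M. R x = N1 x *\<^sub>R (S x \<owedge> S x) + N2 x *\<^sub>R (g x \<owedge> S x) + N3 x *\<^sub>R (g x \<owedge> g x))) \<and>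
     \<comment> \<open>(viii)\<close>
     two_quasi_einstein M g \<and>
     (\<forall>\<alpha> \<in> {\<lambda>x. (2*a - 8*b*r x - F x) / (r x)^2, \<lambda>x. - (4*b / r x)}. \<forall>x\<in>M.
        rank (S x - \<alpha> x *\<^sub>R g x) \<le> 2 \<and>
        (rank (S x - \<alpha> x *\<^sub>R g x) = 2 \<longleftrightarrow> - 2*a + 4*b*r x + F x \<noteq> 0)) \<and>
     \<comment> \<open>(ix)\<close>
     (\<forall>\<phi>1 :: real^4 \<Rightarrow> real. (\<forall>x\<in>M. \<phi>1 x \<noteq> 0) \<longrightarrow>
       (let \<alpha> = (\<lambda>x. - ((- 2*a + 8*b*r x + F x) / (r x)^2));
            \<beta> = (\<lambda>x. 4*b * (- 2*a + 4*b*r x + F x) / ((\<phi>1 x)^2 * r x));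
            \<gamma> = (\<lambda>x. - 2*a + 4*b*r x + F x);
            \<eta> = (\<lambda>x. vector [(q - a*r x) / (\<phi>1 x * (r x)^3), 1 / (\<phi>1 x * (r x)^2), 0, 0]);
            \<Phi> = (\<lambda>x. vector [\<phi>1 x, 0, 0, 0])
        in chaki_for M g \<alpha> \<beta> \<gamma> \<Phi> \<eta> \<and>
           (chaki_for M g \<alpha> \<beta> \<gamma> \<eta> \<Phi> \<longleftrightarrow> (\<forall>x\<in>M. b * (- 2*a + 4*b*r x + F x) = 0)) \<and>
           (\<forall>x\<in>M. form_inner (g x) (\<eta> x) (\<eta> x) = - (4*b / ((\<phi>1 x)^2 * (r x)^3))) \<and>
           (\<forall>x\<in>M. form_inner (g x) (\<Phi> x) (\<Phi> x) = 0))) \<and>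
     \<comment> \<open>(x)\<close>
     (let \<alpha> = (\<lambda>x. - (4*b / r x));
          \<beta> = (\<lambda>x. (- 2*a + 4*b*r x + F x) / (r x)^2);
          \<gamma> = \<beta>;
          \<eta> = (\<lambda>x. vector [0, 0, r x / f (x$3, x$4), 0]);
          \<Phi> = (\<lambda>x. vector [0, 0, 0, r x / f (x$3, x$4)])
      in de_ghosh_for M g \<alpha> \<beta> \<gamma> \<eta> \<Phi> \<and>
         (\<forall>x\<in>M. form_inner (g x) (\<eta> x) (\<eta> x) = - 1 \<and>
                form_inner (g x) (\<Phi> x) (\<Phi> x) = - 1 \<and>
                form_inner (g x) (\<eta> x) (\<Phi> x) = 0)) \<and>
     \<comment> \<open>(xi)\<close>
     (let \<alpha> = (\<lambda>x. - (F x / (2 * (r x)^2)));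
          \<beta> = (\<lambda>x. - (4 * (a - 6*b*r x) / (r x)^2));
          \<gamma> = (\<lambda>x. 1);
          \<eta> = (\<lambda>x. vector [0, 0, 0, r x / f (x$3, x$4)])
      in (\<exists>E. \<forall>x\<in>M. S x = \<alpha> x *\<^sub>R g x + \<beta> x *\<^sub>R form_prod (\<eta> x) (\<eta> x) + \<gamma> x *\<^sub>R E x \<and>
                     metric_trace (g x) (E x) = 0) \<and>
         (pseudo_quasi_einstein_for M g \<alpha> \<beta> \<gamma> \<eta> \<longleftrightarrow> (\<forall>x\<in>M. 4*a - 32*b*r x + F x = 0)) \<and>
         pseudo_quasi_einstein_for M g
           (\<lambda>x. (2*a - 16*b*r x - F x) / (3 * (r x)^2))
           (\<lambda>x. 2 * (- 2*a + 4*b*r x + F x) / (3 * (r x)^2)) \<gamma> \<eta>) \<and>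
     \<comment> \<open>(xii)\<close>
     (\<forall>t11 t12 t22 t33 t34 t44 :: real^4 \<Rightarrow> real.
       (let T = (\<lambda>x. vector [vector [t11 x, t12 x, 0, 0],
                             vector [t12 x, t22 x, 0, 0],
                             vector [0, 0, t33 x, t34 x],
                             vector [0, 0, t34 x, t44 x]])
        in compatible M g R T \<and> compatible M g C T \<and> compatible M g W T \<and> compatible M g K T)) \<and>
     compatible M g R S \<and> compatible M g C S \<and>
     (\<forall>t :: real^4 \<Rightarrow> real.
        \<forall>\<eta> \<in> {\<lambda>x. vector [t x, 0, 0, 0], \<lambda>x. vector [0, t x, 0, 0],
               \<lambda>x. vector [0, 0, t x, 0], \<lambda>x. vector [0, 0, 0, t x]}.
          form_compatible M g R \<eta> \<and> form_compatible M g C \<eta>)"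
proof -
  interpret robinson_trautman a b q f M
    using assms by unfold_locales auto
  show ?thesis
    unfolding Let_def
  proof (intro conjI, goal_cases)
    case 1 show ?case
      using dot_block_g(1)[OF _ riemann_g] unfolding cB_def by blast
  next
    case 2 show ?case
      using dot_block_g(2)[OF _ riemann_g] unfolding cB_def by blast
  next
    case 3 show ?case
      using dot_block_g(3)[OF _ riemann_g] unfolding cB_def by blast
  next
    case 4 show ?case
      using dot_block_g(4)[OF _ riemann_g] unfolding cB_def by blast
  next
    case 5 show ?case
      using dot_block_g(5)[OF _ riemann_g] unfolding cB_def by blast
  next
    case 6 show ?case
      using dot_block_g(6)[OF _ riemann_g] unfolding cB_def by blast
  next
    case 7 show ?case
      using assms(3) by (rule constant_type_iff)
  next
    case 8 show ?case
      using riemann_dot_riemann_minus_tachibana by blast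
  next
    case 9 show ?case
      using dot_block_g(1)[OF _ conformal_g] unfolding cC_def by blast
  next
    case 10 show ?case
      using dot_block_g(2)[OF _ conformal_g] unfolding cC_def by blast
  next
    case 11 show ?case
      using dot_block_g(3)[OF _ conformal_g] unfolding cC_def by blast
  next
    \<comment> \<open>Here the concircular tensor precedes the projective one.\<close>
    case 12 show ?case
      using dot_block_g(5)[OF _ conformal_g] unfolding cC_def by blast
  next
    case 13 show ?case
      using dot_block_g(4)[OF _ conformal_g] unfolding cC_def by blast
  next
    case 14 show ?case
      using dot_block_g(6)[OF _ conformal_g] unfolding cC_def by blast
  next
    case 15 show ?case
      using conformal_dot_commutator_R by blast
  next
    case 16 show ?case
      using conformal_dot_commutator_C by blast
  next
    case 17 show ?case
      by (rule impI) (rule conformal_2_forms_recurrent_g)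
  next
    case 18 show ?case
      using roter_type by blast
  next
    case 19 show ?case
      by (rule two_quasi_einstein_g)
  next
    case 20 show ?case
      by (intro ballI) (rule rank_ricci_minus)
  next
    case 21 show ?case
      by (intro allI impI conjI) (rule chaki_g, assumption)+
  next
    case 22 show ?case
      by (rule de_ghosh_g)
  next
    case 23 show ?case
      using de_ghosh_forms_g by blast
  next
    case 24 show ?case
      by (rule pseudo_quasi_einstein_g(1))
  next
    case 25 show ?case
      by (rule pseudo_quasi_einstein_g(2))
  next
    case 26 show ?case
      by (rule pseudo_quasi_einstein_g(3))
  next
    case 27 show ?case
      by (intro allI conjI; rule compatible_block_form; blast intro: curvature_block_forms)
  next
    case 28 show ?case
      by (intro compatible_block_form curvature_block_forms ricci_block_form)
  next
    case 29 show ?case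
      by (intro compatible_block_form curvature_block_forms ricci_block_form)
  next
    case 30 show ?case
      by (intro allI ballI conjI form_compatible_axis curvature_block_forms)
  qed
qed

end
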